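(* Let $\Lambda=\Lambda(f)$ be an envelope class whose envelope distribution has non-decreasing hazard rate, let $(m_n)_{n\ge1}$ be its exact threshold sequence, and let $Q_n$ be the coding probability of the ETAC-code. Then, as $n\to\infty$, $$(1/4+o_\Lambda(1))\, m_n\log n\le R^+(\Lambda_n)\le R^+(Q_n,\Lambda_n)\le (2+o_\Lambda(1))\, m_n\log n\log m_n .$$ In particular $R^+(Q_n,\Lambda_n)\le (8+o_\Lambda(1))\log m_n\, R^+(\Lambda_n)$, and the multiplicative factor $\log m_n$ is of order $O_\Lambda(\log\log n)$.
   Context: All logarithms are base 2; $o_\Lambda(1)\to0$ as $n\to\infty$ and may depend on $\Lambda$. Envelope classes: for $f:\mathbb N_+\to(0,1]$ with $1<\sum_j f(j)<\infty$, $\Lambda(f)$ is the set of i.i.d. sources with marginal $\mathbb P_1\{j\}\le f(j)$ for all $j$; $\Lambda_n$ is the set of their $n$-symbol restrictions. The envelope distribution is $F(k)=1-\sum_{j>k}f(j)$ when this sum is $<1$, else $0$; a smoothed envelope distribution (still denoted $F$) is a c.d.f. on $\mathbb R_+$ coinciding with $F$ on $\mathbb N$, with continuous derivative positive wherever $F(\lfloor x\rfloor)\in(0,1)$. Non-decreasing hazard rate means that the hazard rate $-\frac{d}{dx}\log\overline F(x)$ of the smoothed envelope distribution is non-decreasing, where $\overline F=1-F$. The exact threshold $m(t)$ is the solution $x$ of $\overline F(x)=x/t$, and $m_n=m(n)$. Redundancy: $R^+(Q_n,\Lambda_n)=\sup_{\mathbb P\in\Lambda}D(\mathbb P_n,Q_n)$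 (Kullback–Leibler, base 2), $R^+(\Lambda_n)=\inf_{Q_n}R^+(Q_n,\Lambda_n)$. ETAC-code: for $x_{1:n}$ let $x_{1,i}\ge\dots\ge x_{i,i}$ be the order statistics of $x_{1:i}$ and $M_i=\min(i,\min\{k:x_{k,i}\le k\})$. The first symbol is not censored; for $i\ge2$, $x_i$ is censored iff $x_i>M_{i-1}$. The censored sequence (censored symbols replaced by $0$) followed by a terminating $0$ is arithmetic-coded with predictive probabilities $\frac{n_i^j+1/2}{i+(M_i+1)/2}$, $j\in\{0,\dots,M_i\}$ ($n_i^j$ = number of occurrences of $j$ in $x_{1:i}$, $n_i^0=0$); each censored $x_i$ is also encoded by the Elias penultimate code of $x_i-M_{i-1}+1$, codewords interleaved. $Q_n\propto2^{-\ell}$ is the coding probability of the resulting codelength $\ell$. *)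

theory Defs
  imports "HOL-Analysis.Analysis" "HOL-Library.Landau_Symbols"
begin

text \<open>Envelopes f are functions on the positive integers; the value f 0 is irrelevant.\<close>

definition is_envelope :: "(nat \<Rightarrow> real) \<Rightarrow> bool" where
  "is_envelope f \<longleftrightarrow> (\<forall>j\<ge>1. 0 < f j \<and> f j \<le> 1) \<and>
     summable (\<lambda>j. f (Suc j)) \<and> 1 < (\<Sum>j. f (Suc j))"

definition tail_sum :: "(nat \<Rightarrow> real) \<Rightarrow> nat \<Rightarrow> real" where
  "tail_sum f k = (\<Sum>i. f (Suc (i + k)))"

definition envelope_cdf :: "(nat \<Rightarrow> real) \<Rightarrow> nat \<Rightarrow> real" where
  "envelope_cdf f k = (if tail_sum f k < 1 then 1 - tail_sum f k else 0)"

text \<open>An i.i.d. source is given by its marginal p on the positive integers (p 0 = 0).\<close>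
definition envelope_class :: "(nat \<Rightarrow> real) \<Rightarrow> (nat \<Rightarrow> real) set" where
  "envelope_class f = {p. p 0 = 0 \<and> (\<forall>j. 0 \<le> p j) \<and> p sums 1 \<and> (\<forall>j\<ge>1. p j \<le> f j)}"

definition seqs :: "nat \<Rightarrow> nat list set" where
  "seqs n = {xs. length xs = n \<and> (\<forall>x\<in>set xs. 0 < x)}"

definition iid_prob :: "(nat \<Rightarrow> real) \<Rightarrow> nat list \<Rightarrow> real" where
  "iid_prob p xs = prod_list (map p xs)"

definition is_coding_prob :: "nat \<Rightarrow> (nat list \<Rightarrow> real) \<Rightarrow> bool" where
  "is_coding_prob n Q \<longleftrightarrow> (\<forall>xs. 0 \<le> Q xs) \<and> (Q has_sum 1) (seqs n)"

definition kl_summand :: "real \<Rightarrow> real \<Rightarrow> ereal" where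
  "kl_summand a b = (if a = 0 then 0 else if b = 0 then \<infinity> else ereal (a * log 2 (a / b)))"

definition KL_div :: "'a set \<Rightarrow> ('a \<Rightarrow> real) \<Rightarrow> ('a \<Rightarrow> real) \<Rightarrow> ereal" where
  "KL_div S P Q =
     enn2ereal (\<integral>\<^sup>+ x. e2ennreal (kl_summand (P x) (Q x)) \<partial>count_space S)
   - enn2ereal (\<integral>\<^sup>+ x. e2ennreal (- kl_summand (P x) (Q x)) \<partial>count_space S)"

definition redundancy :: "(nat \<Rightarrow> real) \<Rightarrow> nat \<Rightarrow> (nat list \<Rightarrow> real) \<Rightarrow> ereal" where
  "redundancy f n Q = (SUP p\<in>envelope_class f. KL_div (seqs n) (iid_prob p) Q)"

definition minimax_redundancy :: "(nat \<Rightarrow> real) \<Rightarrow> nat \<Rightarrow> ereal" where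
  "minimax_redundancy f n = (INF Q\<in>{Q. is_coding_prob n Q}. redundancy f n Q)"

definition smoothed_envelope :: "(nat \<Rightarrow> real) \<Rightarrow> (real \<Rightarrow> real) \<Rightarrow> bool" where
  "smoothed_envelope f F \<longleftrightarrow>
     mono F \<and> (\<forall>x<0. F x = 0) \<and> (F \<longlongrightarrow> 1) at_top \<and> (\<forall>x. continuous (at_right x) F) \<and>
     (\<forall>k::nat. F (real k) = envelope_cdf f k) \<and>
     (\<forall>x>0. F differentiable (at x)) \<and> continuous_on {0<..} (deriv F) \<and>
     (\<forall>x>0. 0 < envelope_cdf f (nat \<lfloor>x\<rfloor>) \<and> envelope_cdf f (nat \<lfloor>x\<rfloor>) < 1 \<longrightarrow> 0 < deriv F x)"

definition hazard_rate :: "(real \<Rightarrow> real) \<Rightarrow> real \<Rightarrow> real" where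
  "hazard_rate F x = - deriv (\<lambda>y. log 2 (1 - F y)) x"

definition nondecreasing_hazard_rate :: "(real \<Rightarrow> real) \<Rightarrow> bool" where
  "nondecreasing_hazard_rate F \<longleftrightarrow> mono_on {x. 0 < x \<and> F x < 1} (hazard_rate F)"

definition exact_threshold :: "(real \<Rightarrow> real) \<Rightarrow> real \<Rightarrow> real" where
  "exact_threshold F t = (THE x. 0 \<le> x \<and> 1 - F x = x / t)"

definition etac_M :: "nat list \<Rightarrow> nat" where
  "etac_M xs = (let i = length xs; ys = rev (sort xs) in
     if \<exists>k. 1 \<le> k \<and> k \<le> i \<and> ys ! (k - 1) \<le> k
     then min i (LEAST k. 1 \<le> k \<and> k \<le> i \<and> ys ! (k - 1) \<le> k) else i)"

definition etac_pred :: "nat list \<Rightarrow> nat \<Rightarrow> real" where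
  "etac_pred xs j = (if j \<le> etac_M xs then
     (real (if j = 0 then 0 else count_list xs j) + 1/2) /
     (real (length xs) + (real (etac_M xs) + 1) / 2) else 0)"

text \<open>Length of the Elias penultimate (delta) codeword of k >= 1.\<close>
definition elias_len :: "nat \<Rightarrow> nat" where
  "elias_len k = 1 + nat \<lfloor>log 2 (real k)\<rfloor> + 2 * nat \<lfloor>log 2 (1 + real_of_int \<lfloor>log 2 (real k)\<rfloor>)\<rfloor>"

text \<open>2^(-codelength) of the ETAC code (arithmetic coding length idealised as -log of
  the coding probability; the first symbol is sent with the Elias code).\<close>
definition etac_weight :: "nat list \<Rightarrow> real" where
  "etac_weight xs = (case xs of [] \<Rightarrow> etac_pred [] 0 | x # _ \<Rightarrow>
     2 powr (- real (elias_len x)) *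
     (\<Prod>i\<in>{1..<length xs}.
        (let ps = take i xs; y = xs ! i; M = etac_M ps in
         if y > M then etac_pred ps 0 * 2 powr (- real (elias_len (y - M + 1)))
         else etac_pred ps y)) *
     etac_pred xs 0)"

definition etac_prob :: "nat \<Rightarrow> nat list \<Rightarrow> real" where
  "etac_prob n xs = (if xs \<in> seqs n then
     etac_weight xs / (\<Sum>\<^sub>\<infinity> ys\<in>seqs n. etac_weight ys) else 0)"

end

(*
Both bounds compare with the log-concave tail Fbar = 1 - F: a non-decreasing hazard rate makes
log Fbar concave with value 0 at 0, so n Fbar(x) >= n^(1 - x/m) for x <= m = m_n, while
n Fbar(5m/4) tends to 0 and m = O(log n).

Lower bound: beyond a constant L the probabilities p(j) <= f(j) can be varied freely.  Putting
about sqrt(n f(j)) / log n grid points on each coordinate j <= m keeps the parameters identifiable from the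
empirical counts (Chebyshev), so the redundancy is at least the logarithm of the size of the grid,
which is sum_j (1/2) log(n f(j)) ~ (1/2) log n * sum_j (1 - j/m) ~ (1/4) m log n.

Upper bound: the sequential probabilities (N+1)/(i+1) would multiply to an inverse multinomial
coefficient, and multinomial coefficient times P(x) is a probability.  Passing from these to the
ETAC probabilities costs O(m log n) on the coded symbols, and about log M + elias on a censored one.
By exchangeability the (i+1)-st symbol lies in the censored range (M, V] with probability at most
V/(i+1), for V = 5m/4, so there are at most (5/4) ln 2 m log n such symbols, each of cost
2 log m + o(log m); symbols above V are too rare to matter.
*)
theory Submission
  imports Defs "HOL-Probability.Probability"
begin

section \<open>Log-concavity of the envelope tail\<close>

text \<open>On an infinite alphabet the values (N+1)/(i+1), summed over the possible next symbols,
  diverge, so they do not form a code. They are only a benchmark, and the fact needed about them is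
  pathwise: their inverse product times P(x) is at most 1, for every source at once.

  The obstacle in the upper bound is that the censoring threshold M is random and depends on the
  past. No concentration of M is proved. M is bounded pathwise by V + 1 plus the number of symbols
  above V, and censoring is counted by asking how many of the first i + 1 symbols would be censored
  if moved to the last place.

  In the lower bound the factor 1 / log n in the grid density makes the union bound work: a
  coordinate fails with probability O(1 / log^2 n), there are O(log n) coordinates, and each pays
  only log log n bits.

  The hazard rate enters mostly through chords from the origin to the graph of the log tail: the
  graph lies above a chord up to its endpoint and below the extended chord after it.\<close>

locale log_concave_envelope =
  fixes f :: "nat \<Rightarrow> real" and F :: "real \<Rightarrow> real"
  assumes env: "is_envelope f" and smooth: "smoothed_envelope f F"
    and hazard: "nondecreasing_hazard_rate F"
begin

lemma f_pos: "1 \<le> j \<Longrightarrow> 0 < f j"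
  using env by (auto simp: is_envelope_def)

lemma summable_f_Suc: "summable (\<lambda>i. f (Suc (i + k)))"
  using env summable_ignore_initial_segment[of "\<lambda>j. f (Suc j)" k] by (auto simp: is_envelope_def)

lemma tail_sum_Suc: "tail_sum f k = f (Suc k) + tail_sum f (Suc k)"
  using suminf_split_head[OF summable_f_Suc[of k]] by (simp add: tail_sum_def)

lemma tail_sum_pos: "0 < tail_sum f k"
  unfolding tail_sum_def by (intro suminf_pos summable_f_Suc f_pos) simp

lemma tail_sum_0: "1 < tail_sum f 0"
  using env by (simp add: is_envelope_def tail_sum_def)

lemma tail_sum_split: "tail_sum f 0 = (\<Sum>j=1..k. f j) + tail_sum f k"
proof (induction k)
  case (Suc k)
  then show ?case using tail_sum_Suc[of k] by simp
qed simp

lemma tail_sum_tendsto: "tail_sum f \<longlonglongrightarrow> 0"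
proof -
  have "(\<lambda>k. \<Sum>i<k. f (Suc i)) \<longlonglongrightarrow> tail_sum f 0"
    using summable_LIMSEQ[OF summable_f_Suc[of 0]] by (simp add: tail_sum_def)
  moreover have "(\<Sum>i<k. f (Suc i)) = (\<Sum>j=1..k. f j)" for k
    by (induction k) auto
  ultimately have "(\<lambda>k. tail_sum f 0 - (\<Sum>j=1..k. f j)) \<longlonglongrightarrow> tail_sum f 0 - tail_sum f 0"
    by (intro tendsto_intros) simp
  moreover have "tail_sum f 0 - (\<Sum>j=1..k. f j) = tail_sum f k" for k
    using tail_sum_split[of k] by linarith
  ultimately show ?thesis by simp
qed

text \<open>Because the tails tend to 0, one \<open>L\<close> serves two purposes:
  \<open>{1..L}\<close> can absorb any leftover mass under the envelope, and from \<open>L\<close>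
  on the truncation at 0 in \<open>envelope_cdf\<close> is inactive.\<close>

lemma exists_absorbing_prefix: "\<exists>L\<ge>1. tail_sum f L < 1 \<and> 1 \<le> (\<Sum>j=1..L. f j)"
proof -
  let ?d = "min 1 (tail_sum f 0 - 1)"
  have "0 < ?d" using tail_sum_0 by simp
  then have "\<forall>\<^sub>F k in sequentially. tail_sum f k < ?d"
    by (intro order_tendstoD(2)[OF tail_sum_tendsto])
  then obtain N where N: "\<And>k. k \<ge> N \<Longrightarrow> tail_sum f k < ?d"
    by (auto simp: eventually_sequentially)
  from N[of "Suc N"] show ?thesis
    using tail_sum_split[of "Suc N"] by (intro exI[of _ "Suc N"]) auto
qed

lemma tail_sum_lt_1_mono:
  assumes "tail_sum f L < 1" "L \<le> V"
  shows "tail_sum f V < 1"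
  using assms(2,1)
proof (induction V rule: dec_induct)
  case (step k)
  then show ?case using tail_sum_Suc[of k] f_pos[of "Suc k"] by linarith
qed simp

section \<open>The smoothed tail and concavity of its logarithm\<close>

definition survival :: "real \<Rightarrow> real" where "survival x = 1 - F x"

definition log_survival :: "real \<Rightarrow> real" where "log_survival x = log 2 (survival x)"

lemma survival_of_nat: "survival (real k) = min 1 (tail_sum f k)"
  using smooth by (auto simp: survival_def smoothed_envelope_def envelope_cdf_def)

lemma survival_antimono: "x \<le> y \<Longrightarrow> survival y \<le> survival x"
  using smooth by (auto simp: survival_def smoothed_envelope_def mono_def)

lemma survival_0: "survival 0 = 1"
  using survival_of_nat[of 0] tail_sum_0 by simp

lemma survival_le_1: "survival x \<le> 1"
proof (cases "0 \<le> x")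
  case True
  then show ?thesis using survival_antimono[of 0 x] survival_0 by simp
next
  case False
  then show ?thesis using smooth by (simp add: survival_def smoothed_envelope_def)
qed

text \<open>Strict positivity of \<open>f\<close> keeps the tail positive at the integers, and
  monotonicity extends this to the reals. The logarithm and the hazard rate are therefore meaningful
  on the whole half-line.\<close>

lemma survival_pos: "0 < survival x"
proof -
  have "0 < survival (real (nat \<lceil>x\<rceil>))"
    unfolding survival_of_nat using tail_sum_pos by simp
  also have "\<dots> \<le> survival x"
    by (intro survival_antimono) linarith
  finally show ?thesis .
qed

lemma log_survival_0: "log_survival 0 = 0"
  by (simp add: log_survival_def survival_0)

lemma survival_eq_powr: "survival x = 2 powr log_survival x"
  using survival_pos by (simp add: log_survival_def)

lemma log_survival_has_derivative:
  assumes "0 < x"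
  shows "(log_survival has_real_derivative - hazard_rate F x) (at x)"
proof -
  have "F differentiable (at x)"
    using smooth assms by (simp add: smoothed_envelope_def)
  then obtain D where "(F has_real_derivative D) (at x)"
    using real_differentiable_def by blast
  moreover have "F x < 1" using survival_pos[of x] by (simp add: survival_def)
  ultimately have "\<exists>E. ((\<lambda>y. log 2 (1 - F y)) has_real_derivative E) (at x)"
    by (intro exI) (auto simp: log_def intro!: derivative_eq_intros)
  then show ?thesis
    unfolding hazard_rate_def log_survival_def survival_def
    by (auto simp: DERIV_imp_deriv)
qed

lemma hazard_rate_mono: "0 < x \<Longrightarrow> x \<le> y \<Longrightarrow> hazard_rate F x \<le> hazard_rate F y"
  using hazard survival_pos unfolding nondecreasing_hazard_rate_def survival_def
  by (auto simp: mono_on_def)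

lemma log_survival_concave: "convex_on {0<..} (\<lambda>x. - log_survival x)"
  using log_survival_has_derivative hazard_rate_mono
  by (intro convex_on_realI[where f' = "hazard_rate F"])
     (auto intro!: derivative_eq_intros)

lemma log_survival_tendsto_0: "(log_survival \<longlongrightarrow> 0) (at_right 0)"
proof -
  have "continuous (at_right 0) F"
    using smooth by (simp add: smoothed_envelope_def)
  then have "(survival \<longlongrightarrow> survival 0) (at_right 0)"
    unfolding survival_def continuous_within by (intro tendsto_intros)
  then have "(log_survival \<longlongrightarrow> log 2 (survival 0)) (at_right 0)"
    unfolding log_survival_def by (intro tendsto_intros) (auto simp: survival_0)
  then show ?thesis by (simp add: survival_0)
qed

lemma isCont_log_survival: "0 < x \<Longrightarrow> isCont log_survival x"
  using log_survival_has_derivative DERIV_isCont by blast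

lemma isCont_survival: "0 < x \<Longrightarrow> isCont survival x"
  using smooth unfolding survival_def smoothed_envelope_def
  by (intro continuous_intros) (auto intro: differentiable_imp_continuous_within)

lemma continuous_on_survival: "continuous_on {0..} survival"
  unfolding continuous_on_eq_continuous_within
proof
  fix x :: real assume x: "x \<in> {0..}"
  show "continuous (at x within {0..}) survival"
  proof (cases "x = 0")
    case True
    have "continuous (at_right 0) survival"
      using smooth unfolding survival_def smoothed_envelope_def
      by (intro continuous_intros) auto
    moreover have "at_right (0::real) = at 0 within {0..}"
      by (simp add: at_within_Ici_at_right)
    ultimately show ?thesis using True by (simp add: continuous_within)
  next
    case False
    then show ?thesis using x isCont_survival[of x] by (simp add: continuous_at_imp_continuous_within)
  qed
qed

text \<open>A concave function vanishing at 0 lies above its chords from the origin. Concavity comes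
  from the derivative and is available only on the open half-line, so the chord is drawn from a
  point \<open>e > 0\<close>, and \<open>e\<close> tends to 0 by right-continuity of
  \<open>F\<close> at 0.\<close>

lemma log_survival_scale:
  assumes "0 \<le> x" "0 \<le> c" "c \<le> 1"
  shows "c * log_survival x \<le> log_survival (c * x)"
proof (cases "x = 0 \<or> c = 0")
  case True
  then show ?thesis using log_survival_0 by auto
next
  case False
  with assms have pos: "0 < x" "0 < c" by auto
  have lim: "((\<lambda>e. log_survival ((1 - c) * e + c * x)) \<longlongrightarrow> log_survival ((1 - c) * 0 + c * x)) (at_right 0)"
    using pos by (intro isCont_tendsto_compose[OF isCont_log_survival] tendsto_intros) auto
  have lim2: "((\<lambda>e. (1 - c) * log_survival e + c * log_survival x)
      \<longlongrightarrow> (1 - c) * 0 + c * log_survival x) (at_right 0)"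
    by (intro tendsto_intros log_survival_tendsto_0)
  have "\<forall>\<^sub>F e in at_right 0. (1 - c) * log_survival e + c * log_survival x
       \<le> log_survival ((1 - c) * e + c * x)"
    using eventually_at_right_less[of 0]
  proof eventually_elim
    case (elim e)
    then show ?case
      using convex_onD[OF log_survival_concave, of c e x] assms pos by (simp add: algebra_simps)
  qed
  from tendsto_le[OF _ lim lim2 this] show ?thesis by simp
qed

text \<open>Both \<open>x\<close> and \<open>y\<close> are fractions of \<open>x + y\<close>, so two
  chord inequalities add up to subadditivity. It later allows the tail at \<open>V\<close> to be
  factored out of all tails beyond \<open>V\<close>.\<close>

lemma log_survival_subadditive:
  assumes "0 \<le> x" "0 \<le> y"
  shows "log_survival (x + y) \<le> log_survival x + log_survival y"
proof (cases "x + y = 0")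
  case True
  then have "x = 0" "y = 0" using assms by auto
  then show ?thesis using log_survival_0 by simp
next
  case False
  then have "x / (x + y) * log_survival (x + y) + y / (x + y) * log_survival (x + y)
      \<le> log_survival x + log_survival y"
    using log_survival_scale[of "x + y" "x / (x + y)"] log_survival_scale[of "x + y" "y / (x + y)"]
      assms by (auto simp: divide_le_eq_1)
  moreover have "x / (x + y) * log_survival (x + y) + y / (x + y) * log_survival (x + y)
     = log_survival (x + y)"
    using False by (simp add: distrib_right[symmetric] add_divide_distrib[symmetric])
  ultimately show ?thesis by simp
qed

lemma survival_submult: "0 \<le> x \<Longrightarrow> 0 \<le> y \<Longrightarrow> survival (x + y) \<le> survival x * survival y"
  using log_survival_subadditive[of x y] by (simp add: survival_eq_powr powr_add[symmetric])

text \<open>By the mean value theorem the two increments are values of minus the hazard rate at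
  points in the same order. The restriction \<open>1 \<le> a\<close> stays away from 0, where
  \<open>F\<close> need not be differentiable.\<close>

lemma log_survival_increment:
  assumes "1 \<le> a" "a \<le> b"
  shows "log_survival (real (Suc b)) - log_survival (real b)
    \<le> log_survival (real (Suc a)) - log_survival (real a)"
proof (cases "a = b")
  case False
  obtain u where u: "real a < u" "u < real (Suc a)"
    "log_survival (real (Suc a)) - log_survival (real a) = (real (Suc a) - real a) * - hazard_rate F u"
    using MVT2[of "real a" "real (Suc a)" log_survival "\<lambda>x. - hazard_rate F x"]
      log_survival_has_derivative assms by auto
  obtain v where v: "real b < v" "v < real (Suc b)"
    "log_survival (real (Suc b)) - log_survival (real b) = (real (Suc b) - real b) * - hazard_rate F v"
    using MVT2[of "real b" "real (Suc b)" log_survival "\<lambda>x. - hazard_rate F x"]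
      log_survival_has_derivative assms by auto
  have "u \<le> v" using u v False assms by linarith
  then show ?thesis using u v hazard_rate_mono[of u v] assms by simp
qed simp

text \<open>Past \<open>L\<close>, \<open>f j\<close> is a difference of consecutive tails. The
  ratio of consecutive tails is non-increasing, hence at most its value at \<open>L\<close>, which
  is below 1 because \<open>f (Suc L)\<close> is positive. Lower bounds on the tail thus transfer to
  \<open>f\<close> itself.\<close>

lemma survival_to_f:
  assumes "1 \<le> L" "tail_sum f L < 1"
  shows "\<exists>c>0. \<forall>j>L. c * survival (real (j - 1)) \<le> f j"
proof -
  have lt: "tail_sum f k < 1" if "L \<le> k" for k
    using assms(2) that by (rule tail_sum_lt_1_mono)
  define c where "c = 1 - 2 powr (log_survival (real (Suc L)) - log_survival (real L))"
  have "survival (real (Suc L)) < survival (real L)"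
    unfolding survival_of_nat using lt[of L] lt[of "Suc L"] tail_sum_Suc[of L] f_pos[of "Suc L"] by simp
  then have "0 < c"
    using survival_pos unfolding c_def by (simp add: powr_less_one log_survival_def)
  moreover have "c * survival (real (j - 1)) \<le> f j" if "L < j" for j
  proof -
    obtain b where j: "j = Suc b" and b: "L \<le> b" using \<open>L < j\<close> by (cases j) auto
    have "f j = survival (real b) - survival (real (Suc b))"
      unfolding survival_of_nat j using lt[of b] lt[of "Suc b"] tail_sum_Suc[of b] b by simp
    also have "\<dots> = survival (real b) * (1 - 2 powr (log_survival (real (Suc b)) - log_survival (real b)))"
      using survival_pos[of "real b"] by (simp add: survival_eq_powr powr_diff field_simps)
    also have "\<dots> \<ge> survival (real b) * c"
      unfolding c_def
      using log_survival_increment[OF assms(1) b] survival_pos[of "real b"]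
      by (intro mult_left_mono diff_left_mono powr_mono) auto
    finally show ?thesis by (simp add: j mult.commute)
  qed
  ultimately show ?thesis by blast
qed

section \<open>Existence, uniqueness and growth of the exact threshold\<close>

definition threshold :: "nat \<Rightarrow> real" where
  "threshold n = exact_threshold F (real n)"

lemma threshold:
  assumes "1 \<le> n"
  shows "0 \<le> threshold n" and "survival (threshold n) = threshold n / real n"
proof -
  have n: "0 < real n" using assms by simp
  have "\<exists>x\<ge>0. x \<le> real n \<and> x / real n - survival x = 0"
  proof (rule IVT')
    show "continuous_on {0..real n} (\<lambda>x. x / real n - survival x)"
      using n by (intro continuous_intros continuous_on_subset[OF continuous_on_survival]) auto
  qed (use n survival_0 survival_le_1 in auto)
  then obtain x where x: "0 \<le> x" "1 - F x = x / real n" by (auto simp: survival_def)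
  \<comment> \<open>Uniqueness, required to unfold \<open>THE\<close>: the tail is non-increasing
    while \<open>x / real n\<close> is strictly increasing.\<close>
  have "y = x" if y: "0 \<le> y" "1 - F y = y / real n" for y
  proof (rule ccontr)
    assume "y \<noteq> x"
    then consider "y < x" | "x < y" by linarith
    then show False
    proof cases
      case 1
      then show ?thesis
        using survival_antimono[of y x] x y divide_strict_right_mono[OF 1 n] by (simp add: survival_def)
    next
      case 2
      then show ?thesis
        using survival_antimono[of x y] x y divide_strict_right_mono[OF 2 n] by (simp add: survival_def)
    qed
  qed
  with x have "\<exists>!x. 0 \<le> x \<and> 1 - F x = x / real n" by blast
  from theI'[OF this] show "0 \<le> threshold n" "survival (threshold n) = threshold n / real n"
    unfolding threshold_def exact_threshold_def survival_def by auto
qed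

lemma threshold_at_top: "filterlim threshold at_top sequentially"
  unfolding filterlim_at_top
proof
  fix K :: real
  define K' where "K' = max K 1"
  have "filterlim real at_top sequentially" by (rule filterlim_real_sequentially)
  then have "\<forall>\<^sub>F n in sequentially. K' / survival K' < real n"
    by (simp add: filterlim_at_top_dense)
  then show "\<forall>\<^sub>F n in sequentially. K \<le> threshold n"
    using eventually_ge_at_top[of 1]
  proof eventually_elim
    case (elim n)
    have "K' \<le> threshold n"
    proof (rule ccontr)
      assume "\<not> ?thesis"
      then have lt: "threshold n < K'" by simp
      then have "survival K' \<le> threshold n / real n"
        using survival_antimono[of "threshold n" K'] threshold[of n] elim by simp
      also have "\<dots> \<le> K' / real n" using lt by (intro divide_right_mono) auto
      also have "\<dots> < survival K'"
        using elim survival_pos[of K'] by (simp add: field_simps)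
      finally show False by simp
    qed
    then show ?case by (simp add: K'_def)
  qed
qed

lemma exists_log_survival_neg: "\<exists>a::nat. 1 \<le> a \<and> log_survival (real a) < 0"
proof -
  obtain L where L: "1 \<le> L" "tail_sum f L < 1" using exists_absorbing_prefix by blast
  then have "survival (real L) < 1" by (simp add: survival_of_nat)
  then show ?thesis
    using L survival_pos[of "real L"] by (intro exI[of _ L]) (simp add: log_survival_def)
qed

text \<open>At the threshold the log tail equals
  \<open>log 2 (threshold n) - log 2 (real n)\<close>. The chord from the origin to that point,
  evaluated at a fixed \<open>a\<close>, lies below the negative number
  \<open>log_survival (real a)\<close>; solving for the threshold gives \<open>C\<close> as the
  inverse slope at \<open>a\<close>.\<close>

lemma threshold_le_log: "\<exists>C>0. \<forall>\<^sub>F n in sequentially. threshold n \<le> C * log 2 (real n)"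
proof -
  obtain a :: nat where a: "1 \<le> a" "log_survival (real a) < 0"
    using exists_log_survival_neg by blast
  define C where "C = - (real a / log_survival (real a))"
  have "0 < C" unfolding C_def using a by (simp add: divide_pos_neg)
  moreover have "\<forall>\<^sub>F n in sequentially. real a \<le> threshold n"
    using threshold_at_top by (simp add: filterlim_at_top)
  then have "\<forall>\<^sub>F n in sequentially. threshold n \<le> C * log 2 (real n)"
    using eventually_ge_at_top[of 1]
  proof eventually_elim
    case (elim n)
    let ?m = "threshold n"
    have m: "1 \<le> ?m" using elim a by simp
    have "real a / ?m * log_survival ?m \<le> log_survival (real a / ?m * ?m)"
      using elim m by (intro log_survival_scale) auto
    then have "real a / ?m * log_survival ?m \<le> log_survival (real a)" using m by simp
    moreover have "log_survival ?m = log 2 ?m - log 2 (real n)"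
      using threshold[of n] elim m by (simp add: log_survival_def log_divide)
    moreover have "0 \<le> real a / ?m * log 2 ?m" using m by simp
    ultimately have "real a / ?m * - log 2 (real n) \<le> log_survival (real a)"
      by (simp only: right_diff_distrib mult_minus_right)
    then have "real a * - log 2 (real n) \<le> log_survival (real a) * ?m"
      using m by (simp add: field_simps)
    then show ?case using a unfolding C_def by (simp add: field_simps)
  qed
  ultimately show ?thesis by blast
qed

text \<open>A quarter beyond the threshold the log-concave tail has already gained a positive power of
  \<open>n\<close>, so no symbol that large is expected; the rate \<open>5/4\<close> is affordable because it is
  below \<open>1 / ln 2\<close>.\<close>
lemma survival_beyond_threshold:
  assumes "1 \<le> n" "1 \<le> threshold n" "5/4 * threshold n \<le> x"
  shows "survival x \<le> (threshold n / real n) powr (5/4)"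
proof -
  let ?m = "threshold n"
  have "survival x \<le> survival (5/4 * ?m)" by (intro survival_antimono assms)
  also have "\<dots> \<le> survival ?m powr (5/4)"
  proof -
    have "4/5 * log_survival (5/4 * ?m) \<le> log_survival (4/5 * (5/4 * ?m))"
      using assms by (intro log_survival_scale) auto
    then have "log_survival (5/4 * ?m) \<le> log_survival ?m * (5/4)" by simp
    then show ?thesis by (simp add: survival_eq_powr powr_powr)
  qed
  finally show ?thesis using threshold[of n] assms by simp
qed

end

section \<open>Memoryless sources and Kullback--Leibler divergence\<close>

lemma pmf_replicate_pmf: "length xs = n \<Longrightarrow> pmf (replicate_pmf n q) xs = prod_list (map (pmf q) xs)"
proof (induction n arbitrary: xs)
  case (Suc n)
  then obtain y ys where xs: "xs = y # ys" "length ys = n" by (cases xs) auto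
  have "replicate_pmf (Suc n) q = map_pmf (\<lambda>(x, xs). x # xs) (pair_pmf q (replicate_pmf n q))"
    by (simp add: pair_pmf_def map_bind_pmf map_pmf_def bind_assoc_pmf bind_return_pmf)
  then have "pmf (replicate_pmf (Suc n) q) xs
      = pmf (map_pmf (\<lambda>(x, xs). x # xs) (pair_pmf q (replicate_pmf n q))) ((\<lambda>(x, xs). x # xs) (y, ys))"
    by (simp add: xs)
  also have "\<dots> = pmf (pair_pmf q (replicate_pmf n q)) (y, ys)"
    by (intro pmf_map_inj') (auto simp: inj_def)
  finally show ?case using Suc.IH[of ys] xs by (simp add: pmf_pair)
qed simp

definition is_source :: "(nat \<Rightarrow> real) \<Rightarrow> bool" where
  "is_source p \<longleftrightarrow> p 0 = 0 \<and> (\<forall>j. 0 \<le> p j) \<and> p sums 1"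

definition iid_pmf :: "nat \<Rightarrow> (nat \<Rightarrow> real) \<Rightarrow> nat list pmf" where
  "iid_pmf n p = replicate_pmf n (embed_pmf p)"

lemma pmf_embed_source: "is_source p \<Longrightarrow> pmf (embed_pmf p) j = p j"
proof (rule pmf_embed_pmf)
  assume p: "is_source p"
  have "(\<integral>\<^sup>+ x. ennreal (p x) \<partial>count_space UNIV) = (\<Sum>x. ennreal (p x))"
    by (rule nn_integral_count_space_nat)
  also have "\<dots> = ennreal 1"
    using p by (intro suminf_ennreal_eq) (auto simp: is_source_def)
  finally show "(\<integral>\<^sup>+ x. ennreal (p x) \<partial>count_space UNIV) = 1" by simp
qed (simp add: is_source_def)

lemma set_iid_pmf: "is_source p \<Longrightarrow> set_pmf (iid_pmf n p) \<subseteq> seqs n"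
  using pmf_embed_source[of p 0]
  by (auto simp: iid_pmf_def set_replicate_pmf seqs_def set_pmf_iff is_source_def intro!: gr0I)

lemma pmf_iid_pmf: "is_source p \<Longrightarrow> xs \<in> seqs n \<Longrightarrow> pmf (iid_pmf n p) xs = iid_prob p xs"
  using pmf_embed_source[of p]
  by (simp add: iid_pmf_def pmf_replicate_pmf seqs_def iid_prob_def fun_eq_iff[symmetric] cong: map_cong)

lemma iid_prob_nonneg: "is_source p \<Longrightarrow> 0 \<le> iid_prob p xs"
  unfolding iid_prob_def is_source_def by (induction xs) auto

lemma nn_integral_iid:
  assumes "is_source p"
  shows "(\<integral>\<^sup>+xs. ennreal (iid_prob p xs) * h xs \<partial>count_space (seqs n)) = (\<integral>\<^sup>+xs. h xs \<partial>iid_pmf n p)"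
proof -
  have "(\<integral>\<^sup>+xs. h xs \<partial>iid_pmf n p) = (\<integral>\<^sup>+xs. ennreal (pmf (iid_pmf n p) xs) * h xs \<partial>count_space UNIV)"
    by (rule nn_integral_measure_pmf)
  also have "\<dots> = (\<integral>\<^sup>+xs. ennreal (pmf (iid_pmf n p) xs) * h xs \<partial>count_space (seqs n))"
    using set_iid_pmf[OF assms, of n] by (intro nn_integral_count_space_eq) (auto simp: set_pmf_iff)
  also have "\<dots> = (\<integral>\<^sup>+xs. ennreal (iid_prob p xs) * h xs \<partial>count_space (seqs n))"
    by (intro nn_integral_cong) (simp add: pmf_iid_pmf[OF assms])
  finally show ?thesis by simp
qed

lemma iid_pmf_Suc:
  "(\<integral>\<^sup>+xs. h xs \<partial>iid_pmf (Suc n) p) = (\<integral>\<^sup>+x. \<integral>\<^sup>+xs. h (x # xs) \<partial>iid_pmf n p \<partial>embed_pmf p)"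
  by (simp add: iid_pmf_def)

lemma nn_integral_iid_nth:
  "i < n \<Longrightarrow> (\<integral>\<^sup>+xs. h (xs ! i) \<partial>iid_pmf n p) = (\<integral>\<^sup>+x. h x \<partial>embed_pmf p)"
proof (induction n arbitrary: i)
  case (Suc n)
  then show ?case by (cases i) (simp_all add: iid_pmf_Suc)
qed simp

lemma nn_integral_source:
  assumes "is_source p"
  shows "(\<integral>\<^sup>+x. h x \<partial>embed_pmf p) = (\<Sum>j. ennreal (p (Suc j)) * h (Suc j))"
proof -
  have "(\<integral>\<^sup>+x. h x \<partial>embed_pmf p) = (\<Sum>j. ennreal (p j) * h j)"
    by (simp add: nn_integral_measure_pmf pmf_embed_source[OF assms] nn_integral_count_space_nat)
  also have "\<dots> = (\<Sum>j. ennreal (p (Suc j)) * h (Suc j))"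
    using suminf_offset[of "\<lambda>j. ennreal (p j) * h j" 1] assms by (simp add: is_source_def)
  finally show ?thesis .
qed

section \<open>Exchangeability and moments of the empirical counts\<close>

definition swap_nth :: "nat \<Rightarrow> nat \<Rightarrow> 'a list \<Rightarrow> 'a list" where
  "swap_nth i j xs = xs[j := xs ! i, i := xs ! j]"

lemma swap_nth_simps:
  assumes "i < length xs" "j < length xs"
  shows "length (swap_nth i j xs) = length xs" "mset (swap_nth i j xs) = mset xs"
    "swap_nth i j (swap_nth i j xs) = xs" "swap_nth i j xs ! i = xs ! j"
  using assms by (auto simp: swap_nth_def mset_swap nth_list_update intro!: nth_equalityI)

text \<open>The probability of a word depends only on its multiset of symbols, and a swap is an
  involution on the words of length \<open>n\<close>.\<close>

lemma nn_integral_iid_swap: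
  assumes "i < n" "j < n"
  shows "(\<integral>\<^sup>+xs. h (swap_nth i j xs) \<partial>iid_pmf n p) = (\<integral>\<^sup>+xs. h xs \<partial>iid_pmf n p)"
proof -
  let ?L = "{xs :: nat list. length xs = n}"
  have *: "(\<integral>\<^sup>+xs. g xs \<partial>iid_pmf n p) = (\<integral>\<^sup>+xs. ennreal (pmf (iid_pmf n p) xs) * g xs \<partial>count_space ?L)"
    for g :: "nat list \<Rightarrow> ennreal"
    unfolding nn_integral_measure_pmf
    by (intro nn_integral_count_space_eq) (auto simp: pmf_eq_0_set_pmf iid_pmf_def set_replicate_pmf)
  have bij: "bij_betw (swap_nth i j) ?L ?L"
    using assms by (intro bij_betw_byWitness[where f' = "swap_nth i j"]) (auto simp: swap_nth_simps)
  have "pmf (iid_pmf n p) (swap_nth i j xs) = pmf (iid_pmf n p) xs" if "xs \<in> ?L" for xs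
  proof -
    have "mset (map (pmf (embed_pmf p)) (swap_nth i j xs)) = mset (map (pmf (embed_pmf p)) xs)"
      using that assms by (simp add: swap_nth_simps)
    then have "prod_list (map (pmf (embed_pmf p)) (swap_nth i j xs)) = prod_list (map (pmf (embed_pmf p)) xs)"
      by (metis prod_mset_prod_list)
    then show ?thesis
      using that assms by (simp add: iid_pmf_def pmf_replicate_pmf swap_nth_simps)
  qed
  then have "(\<integral>\<^sup>+xs. h (swap_nth i j xs) \<partial>iid_pmf n p)
      = (\<integral>\<^sup>+xs. ennreal (pmf (iid_pmf n p) (swap_nth i j xs)) * h (swap_nth i j xs) \<partial>count_space ?L)"
    unfolding * by (intro nn_integral_cong) simp
  also have "\<dots> = (\<integral>\<^sup>+xs. h xs \<partial>iid_pmf n p)"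
    unfolding * by (rule nn_integral_bij_count_space[OF bij])
  finally show ?thesis .
qed

text \<open>Binomial variance plus squared bias. The centre \<open>c\<close> is arbitrary because
  conditioning on a first symbol equal to \<open>j\<close> moves it to \<open>c - 1\<close>; the
  induction would not close for the mean alone.\<close>

lemma count_list_second_moment:
  "(\<integral>\<^sup>+xs. ennreal ((real (count_list xs j) - c)\<^sup>2) \<partial>replicate_pmf n q)
     = ennreal (real n * pmf q j * (1 - pmf q j) + (real n * pmf q j - c)\<^sup>2)"
proof (induction n arbitrary: c)
  case (Suc n)
  let ?a = "pmf q j"
  let ?E = "\<lambda>c. real n * ?a * (1 - ?a) + (real n * ?a - c)\<^sup>2"
  have a: "0 \<le> ?a" "?a \<le> 1" by (auto simp: pmf_le_1)
  have E: "0 \<le> ?E c" for c using a by (intro add_nonneg_nonneg mult_nonneg_nonneg) auto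
  have "(\<integral>\<^sup>+xs. ennreal ((real (count_list xs j) - c)\<^sup>2) \<partial>replicate_pmf (Suc n) q)
      = (\<integral>\<^sup>+x. (\<integral>\<^sup>+xs. ennreal ((real (count_list (x # xs) j) - c)\<^sup>2) \<partial>replicate_pmf n q) \<partial>q)"
    by simp
  also have "\<dots> = (\<integral>\<^sup>+x. ennreal (?E (c - 1)) * indicator {j} x + ennreal (?E c) * indicator (- {j}) x \<partial>q)"
  proof (intro nn_integral_cong)
    fix x
    have "real (count_list (x # xs) j) - c = real (count_list xs j) - (if x = j then c - 1 else c)" for xs
      by simp
    then show "(\<integral>\<^sup>+xs. ennreal ((real (count_list (x # xs) j) - c)\<^sup>2) \<partial>replicate_pmf n q)
       = ennreal (?E (c - 1)) * indicator {j} x + ennreal (?E c) * indicator (- {j}) x"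
      by (simp only: Suc.IH) simp
  qed
  also have "\<dots> = ennreal (?E (c - 1)) * emeasure q {j} + ennreal (?E c) * emeasure q (- {j})"
    by (subst nn_integral_add) (auto simp: nn_integral_cmult)
  also have "emeasure q (- {j}) = ennreal (1 - ?a)"
    using measure_pmf.prob_compl[of "{j}" q]
    by (simp add: measure_pmf.emeasure_eq_measure Compl_eq_Diff_UNIV measure_pmf_single)
  also have "emeasure q {j} = ennreal ?a" by (simp add: emeasure_pmf_single)
  also have "ennreal (?E (c - 1)) * ennreal ?a + ennreal (?E c) * ennreal (1 - ?a)
     = ennreal (?E (c - 1) * ?a + ?E c * (1 - ?a))"
    using a E[of c] E[of "c - 1"] by (simp add: ennreal_mult'[symmetric] ennreal_plus[symmetric] del: ennreal_plus)
  also have "?E (c - 1) * ?a + ?E c * (1 - ?a) = real (Suc n) * ?a * (1 - ?a) + (real (Suc n) * ?a - c)\<^sup>2"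
    by (simp add: power2_eq_square algebra_simps)
  finally show ?case .
qed simp

text \<open>Chebyshev's inequality, with the variance bounded by the mean.\<close>

lemma count_list_deviation:
  assumes "0 < t"
  shows "measure (replicate_pmf n q) {xs. t \<le> \<bar>real (count_list xs j) - real n * pmf q j\<bar>}
    \<le> real n * pmf q j / t\<^sup>2"
proof -
  let ?Y = "\<lambda>xs. real (count_list xs j) - real n * pmf q j"
  let ?B = "{xs. t \<le> \<bar>?Y xs\<bar>}"
  have "emeasure (replicate_pmf n q) ?B = (\<integral>\<^sup>+xs. indicator ?B xs \<partial>replicate_pmf n q)"
    by simp
  also have "\<dots> \<le> (\<integral>\<^sup>+xs. ennreal (1 / t\<^sup>2) * ennreal ((?Y xs)\<^sup>2) \<partial>replicate_pmf n q)"
  proof (intro nn_integral_mono)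
    fix xs
    have "1 \<le> 1 / t\<^sup>2 * (?Y xs)\<^sup>2" if "xs \<in> ?B"
    proof -
      have "t\<^sup>2 \<le> \<bar>?Y xs\<bar>\<^sup>2" using that assms by (intro power_mono) auto
      then show ?thesis using assms by (simp add: field_simps)
    qed
    then have "indicator ?B xs \<le> ennreal (1 / t\<^sup>2 * (?Y xs)\<^sup>2)"
      by (auto simp: indicator_def simp flip: ennreal_1 intro!: ennreal_leI)
    then show "indicator ?B xs \<le> ennreal (1 / t\<^sup>2) * ennreal ((?Y xs)\<^sup>2)"
      by (subst ennreal_mult'[symmetric]) auto
  qed
  also have "\<dots> = ennreal (1 / t\<^sup>2) * ennreal (real n * pmf q j * (1 - pmf q j))"
    by (subst nn_integral_cmult) (simp_all add: count_list_second_moment)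
  also have "\<dots> = ennreal (1 / t\<^sup>2 * (real n * pmf q j * (1 - pmf q j)))"
    by (subst ennreal_mult'[symmetric]) auto
  also have "\<dots> \<le> ennreal (real n * pmf q j / t\<^sup>2)"
    using assms by (intro ennreal_leI) (simp add: field_simps pmf_le_1 mult_left_le)
  finally show ?thesis
    by (simp add: measure_pmf.emeasure_eq_measure)
qed

section \<open>Kullback-Leibler divergence from above and from below\<close>

lemma KL_div_le:
  assumes "\<And>x. x \<in> S \<Longrightarrow> kl_summand (P x) (Q x) \<le> ereal (P x * B x)"
    and "\<And>x. x \<in> S \<Longrightarrow> 0 \<le> P x"
    and "(\<integral>\<^sup>+x. ennreal (P x) * ennreal (B x) \<partial>count_space S) \<le> ennreal C" and "0 \<le> C"
  shows "KL_div S P Q \<le> ereal C"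
proof -
  have "(\<integral>\<^sup>+ x. e2ennreal (kl_summand (P x) (Q x)) \<partial>count_space S)
      \<le> (\<integral>\<^sup>+x. ennreal (P x) * ennreal (B x) \<partial>count_space S)"
  proof (intro nn_integral_mono)
    fix x assume "x \<in> space (count_space S)"
    then have "e2ennreal (kl_summand (P x) (Q x)) \<le> e2ennreal (ereal (P x * B x))" "0 \<le> P x"
      using assms(1)[of x] assms(2)[of x] by (simp_all only: e2ennreal_mono space_count_space)
    then show "e2ennreal (kl_summand (P x) (Q x)) \<le> ennreal (P x) * ennreal (B x)"
      by (simp add: ennreal_mult'[symmetric] e2ennreal_ereal)
  qed
  also have "\<dots> \<le> ennreal C" by fact
  finally have "enn2ereal (\<integral>\<^sup>+ x. e2ennreal (kl_summand (P x) (Q x)) \<partial>count_space S) \<le> enn2ereal (ennreal C)"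
    by (simp add: less_eq_ennreal.rep_eq)
  then show ?thesis
    unfolding KL_div_def using assms(4)
    by (intro ereal_diff_le_mono_left) auto
qed

text \<open>This is \<open>ln t \<le> t - 1\<close> at \<open>t = c * b / a\<close>. The free factor
  \<open>c\<close> is a test weight: letting it depend on the point and summing gives a variational
  lower bound on the divergence.\<close>

lemma kl_summand_ge:
  assumes "0 \<le> a" "0 \<le> b" "0 < c"
  shows "ereal ((a - c * b) / ln 2 + a * log 2 c) \<le> kl_summand a b"
proof (cases "a = 0 \<or> b = 0")
  case False
  then have pos: "0 < a" "0 < b" using assms by auto
  have "a * ln (c * b / a) \<le> a * (c * b / a - 1)"
    using pos assms by (intro mult_left_mono ln_le_minus_one) auto
  also have "\<dots> = c * b - a" using pos by (simp add: field_simps)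
  finally have "(a - c * b) / ln 2 \<le> a * - ln (c * b / a) / ln 2"
    by (intro divide_right_mono) auto
  also have "a * - ln (c * b / a) / ln 2 + a * log 2 c = a * log 2 (a / b)"
    using pos assms by (simp add: log_def ln_mult ln_div field_simps)
  finally show ?thesis using pos by (simp add: kl_summand_def)
qed (use assms in \<open>auto simp: kl_summand_def\<close>)

text \<open>Data processing for a single event of \<open>Q\<close>-probability at most \<open>1 / c\<close>.\<close>
lemma KL_div_ge:
  assumes P: "\<And>x. x \<in> S \<Longrightarrow> 0 \<le> P x" and Q: "\<And>x. x \<in> S \<Longrightarrow> 0 \<le> Q x"
    and Q1: "(\<integral>\<^sup>+x. ennreal (Q x) \<partial>count_space S) \<le> 1"
    and QA: "(\<integral>\<^sup>+x. ennreal (Q x) * indicator A x \<partial>count_space S) \<le> ennreal (1 / c)"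
    and PA: "ennreal d \<le> (\<integral>\<^sup>+x. ennreal (P x) * indicator A x \<partial>count_space S)"
    and c: "1 \<le> c" and d: "0 \<le> d"
  shows "ereal (d * log 2 c - 2 / ln 2) \<le> KL_div S P Q"
proof -
  let ?kl = "\<lambda>x. kl_summand (P x) (Q x)"
  let ?pos = "\<integral>\<^sup>+x. e2ennreal (?kl x) \<partial>count_space S"
  let ?neg = "\<integral>\<^sup>+x. e2ennreal (- ?kl x) \<partial>count_space S"
  have lc: "0 \<le> log 2 c" using c by simp
  \<comment> \<open>The positive and negative parts of the summand stay on opposite sides of the
    inequality, so no difference of infinite integrals arises.\<close>
  have pw: "ennreal (log 2 c) * (ennreal (P x) * indicator A x) + e2ennreal (- ?kl x)
      \<le> e2ennreal (?kl x) + (ennreal (1 / ln 2) * ennreal (Q x) + ennreal (c / ln 2) * (ennreal (Q x) * indicator A x))"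
    if x: "x \<in> S" for x
  proof -
    \<comment> \<open>The test weight is \<open>c\<close> on the event and 1 off it.\<close>
    define e where "e = (if x \<in> A then c else 1)"
    have ge: "ereal ((P x - e * Q x) / ln 2 + P x * log 2 e) \<le> ?kl x"
      using P Q x c by (intro kl_summand_ge) (auto simp: e_def)
    show ?thesis
    proof (cases "?kl x")
      case PInf
      then show ?thesis by (simp add: e2ennreal_infty top_add)
    next
      case MInf
      then show ?thesis using ge by simp
    next
      case (real k)
      have "P x * log 2 e - k \<le> e * Q x / ln 2"
      proof -
        have "0 \<le> P x / ln 2" using P x by simp
        then show ?thesis using ge real by (simp add: diff_divide_distrib)
      qed
      moreover have "P x * log 2 e = log 2 c * (P x * indicator A x)"
        by (simp add: e_def)
      moreover have "e * Q x / ln 2 \<le> 1 / ln 2 * Q x + c / ln 2 * (Q x * indicator A x)"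
        using Q x by (auto simp: e_def)
      ultimately have *: "log 2 c * (P x * indicator A x) + max 0 (- k)
         \<le> max 0 k + (1 / ln 2 * Q x + c / ln 2 * (Q x * indicator A x))"
        by (smt (verit))
      have "ennreal (log 2 c) * (ennreal (P x) * indicator A x) + e2ennreal (- ?kl x)
        = ennreal (log 2 c * (P x * indicator A x) + max 0 (- k))"
        using lc P x real
        by (auto simp: indicator_def ennreal_mult'[symmetric] e2ennreal_ereal  max_def
           ennreal_neg simp flip: ennreal_plus)
      also have "\<dots> \<le> ennreal (max 0 k + (1 / ln 2 * Q x + c / ln 2 * (Q x * indicator A x)))"
        using * by (intro ennreal_leI)
      also have "\<dots> = e2ennreal (?kl x) + (ennreal (1 / ln 2) * ennreal (Q x) + ennreal (c / ln 2) * (ennreal (Q x) * indicator A x))"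
        using c Q x real
        by (auto simp: indicator_def ennreal_mult'[symmetric] e2ennreal_ereal max_def
            ennreal_neg simp flip: ennreal_plus)
      finally show ?thesis .
    qed
  qed
  have "ennreal (log 2 c * d) + ?neg
     \<le> ennreal (log 2 c) * (\<integral>\<^sup>+x. ennreal (P x) * indicator A x \<partial>count_space S) + ?neg"
    using PA lc by (intro add_right_mono) (simp add: ennreal_mult' mult_left_mono)
  also have "\<dots> = (\<integral>\<^sup>+x. ennreal (log 2 c) * (ennreal (P x) * indicator A x) + e2ennreal (- ?kl x) \<partial>count_space S)"
    by (simp add: nn_integral_add nn_integral_cmult)
  also have "\<dots> \<le> (\<integral>\<^sup>+x. e2ennreal (?kl x) + (ennreal (1 / ln 2) * ennreal (Q x)
      + ennreal (c / ln 2) * (ennreal (Q x) * indicator A x)) \<partial>count_space S)"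
    by (intro nn_integral_mono pw) simp
  also have "\<dots> = ?pos + (ennreal (1 / ln 2) * (\<integral>\<^sup>+x. ennreal (Q x) \<partial>count_space S)
      + ennreal (c / ln 2) * (\<integral>\<^sup>+x. ennreal (Q x) * indicator A x \<partial>count_space S))"
    by (simp add: nn_integral_add nn_integral_cmult)
  also have "\<dots> \<le> ?pos + (ennreal (1 / ln 2) * 1 + ennreal (c / ln 2) * ennreal (1 / c))"
    using Q1 QA by (intro add_mono mult_left_mono) auto
  \<comment> \<open>The loss \<open>2 / ln 2\<close> has two equal parts: the total mass of
    \<open>Q\<close>, and \<open>c\<close> times the mass of \<open>A\<close>, each at most
    1.\<close>
  also have "ennreal (1 / ln 2) * 1 + ennreal (c / ln 2) * ennreal (1 / c) = ennreal (2 / ln 2)"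
    using c by (simp add: ennreal_mult'[symmetric] ennreal_plus[symmetric] del: ennreal_plus)
  finally have main: "ennreal (log 2 c * d) + ?neg \<le> ?pos + ennreal (2 / ln 2)" .
  have "enn2ereal (ennreal (log 2 c * d)) + enn2ereal ?neg \<le> enn2ereal ?pos + enn2ereal (ennreal (2 / ln 2))"
    using main by (simp add: less_eq_ennreal.rep_eq plus_ennreal.rep_eq)
  then have le: "ereal (log 2 c * d) + enn2ereal ?neg \<le> enn2ereal ?pos + ereal (2 / ln 2)"
    using lc d by simp
  show ?thesis
  proof (cases "enn2ereal ?pos = \<infinity>")
    case True
    then show ?thesis unfolding KL_div_def by simp
  next
    case False
    moreover have "0 \<le> enn2ereal ?pos" "0 \<le> enn2ereal ?neg" by simp_all
    ultimately obtain a b where "enn2ereal ?pos = ereal a" "enn2ereal ?neg = ereal b"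
      using le by (cases "enn2ereal ?pos"; cases "enn2ereal ?neg") auto
    then show ?thesis unfolding KL_div_def using le by (simp add: mult.commute)
  qed
qed

section \<open>The minimax lower bound\<close>

lemma log_prod:
  assumes "finite I" "\<And>i. i \<in> I \<Longrightarrow> 0 < (f i :: real)"
  shows "log b (\<Prod>i\<in>I. f i) = (\<Sum>i\<in>I. log b (f i))"
proof -
  have "f i \<noteq> 0" if "i \<in> I" for i using assms(2)[OF that] by simp
  then show ?thesis using assms(1) by (simp add: log_def ln_prod sum_divide_distrib)
qed

lemma nn_integral_has_sum:
  fixes Q :: "'a \<Rightarrow> real"
  assumes "\<And>x. x \<in> A \<Longrightarrow> 0 \<le> Q x" "(Q has_sum s) A"
  shows "(\<integral>\<^sup>+x. ennreal (Q x) \<partial>count_space A) = ennreal s"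
proof -
  have "Q summable_on A" using assms(2) unfolding summable_on_def by blast
  then have abs: "Infinite_Set_Sum.abs_summable_on Q A"
    by (rule iffD1[OF abs_summable_equivalent iffD1[OF summable_on_iff_abs_summable_on_real]])
  then have "(\<integral>\<^sup>+x. ennreal (Q x) \<partial>count_space A) = ennreal (infsetsum Q A)"
    using assms(1) unfolding infsetsum_def abs_summable_on_def
    by (intro nn_integral_eq_integral) (auto simp: AE_count_space)
  also have "infsetsum Q A = s"
    using infsetsum_infsum[OF abs] assms(2) by (simp add: infsumI)
  finally show ?thesis .
qed

lemma has_sum_of_nn_integral:
  fixes Q :: "'a \<Rightarrow> real"
  assumes "\<And>x. x \<in> A \<Longrightarrow> 0 \<le> Q x" "(\<integral>\<^sup>+x. ennreal (Q x) \<partial>count_space A) = ennreal s" "0 \<le> s"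
  shows "(Q has_sum s) A"
proof -
  have "integrable (count_space A) Q"
    using assms by (intro integrableI_nonneg) (auto simp: AE_count_space)
  then have abs: "Infinite_Set_Sum.abs_summable_on Q A" by (simp add: abs_summable_on_def)
  then have "Q summable_on A"
    using abs_summable_equivalent[of Q A] abs_summable_summable by blast
  then have "(Q has_sum infsum Q A) A" by simp
  moreover have "infsum Q A = s"
    using infsetsum_infsum[OF abs] assms nn_integral_has_sum[OF assms(1) \<open>(Q has_sum infsum Q A) A\<close>]
      infsum_nonneg[of A Q] by auto
  ultimately show ?thesis by simp
qed

text \<open>The smallest of finitely many masses is at most their average. Applied to disjoint
  acceptance cells, it finds a parameter that a given coding distribution treats badly.\<close>

lemma exists_small_mass:
  fixes q :: "'b \<Rightarrow> ennreal"
  assumes "finite T" "T \<noteq> {}" "(\<Sum>t\<in>T. q t) \<le> 1"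
  shows "\<exists>t\<in>T. q t \<le> ennreal (1 / real (card T))"
proof (rule ccontr)
  assume neg: "\<not> ?thesis"
  have c: "0 < real (card T)" using assms by (simp add: card_gt_0_iff)
  have le1: "q t \<le> 1" if "t \<in> T" for t
    using assms that by (meson member_le_sum order_trans zero_le)
  have fin: "q t = ennreal (enn2real (q t))" if "t \<in> T" for t
    using le1[OF that] by (metis ennreal_enn2real_if ennreal_one_neq_top neq_top_trans)
  have "1 / real (card T) < enn2real (q t)" if "t \<in> T" for t
  proof (rule ccontr)
    assume "\<not> ?thesis"
    then have "ennreal (enn2real (q t)) \<le> ennreal (1 / real (card T))"
      by (intro ennreal_leI) simp
    then show False using neg that fin[OF that] by auto
  qed
  then have "(\<Sum>t\<in>T. 1 / real (card T)) < (\<Sum>t\<in>T. enn2real (q t))"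
    using assms by (intro sum_strict_mono) auto
  moreover have "ennreal (\<Sum>t\<in>T. enn2real (q t)) = (\<Sum>t\<in>T. q t)"
    using fin by (subst sum_ennreal[symmetric]) auto
  then have "(\<Sum>t\<in>T. enn2real (q t)) \<le> 1"
    using assms(3) by (metis ennreal_le_1)
  ultimately show False using c by simp
qed

context log_concave_envelope
begin

text \<open>The symbols of \<open>J\<close> carry independent parameters on a grid coarse enough for the
  empirical frequencies to identify every grid point; the remaining mass is spread over \<open>{1..L}\<close>.\<close>
lemma minimax_redundancy_ge:
  fixes K :: "nat \<Rightarrow> nat"
  assumes L: "tail_sum f L < 1" "1 \<le> (\<Sum>j=1..L. f j)"
    and J: "finite J" "\<And>j. j \<in> J \<Longrightarrow> L < j" and K: "\<And>j. j \<in> J \<Longrightarrow> 1 \<le> K j" and n: "1 \<le> n"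
    and d: "(\<Sum>j\<in>J. 4 * (real (K j))\<^sup>2 / (real n * f j)) \<le> d" "d \<le> 1"
  shows "ereal ((1 - d) * (\<Sum>j\<in>J. log 2 (real (K j))) - 2 / ln 2) \<le> minimax_redundancy f n"
proof -
  define T where "T = PiE J (\<lambda>j. {1..K j})"
  define S where "S = (\<Sum>j=1..L. f j)"
  \<comment> \<open>The mass left over by the grid coordinates is spread over \<open>{1..L}\<close>
    in proportion to \<open>f\<close>; since \<open>r \<theta> \<le> 1 \<le> S\<close>, it stays
    under the envelope.\<close>
  define r where "r = (\<lambda>\<theta>. 1 - (\<Sum>j\<in>J. f j * real (\<theta> j) / real (K j)))"
  define p where "p = (\<lambda>\<theta> j. if j \<in> J then f j * real (\<theta> j) / real (K j)
     else if 1 \<le> j \<and> j \<le> L then r \<theta> * f j / S else 0)"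
  \<comment> \<open>The acceptance cell of a parameter: each count is within half a grid step,
    measured in counts, of its mean.\<close>
  define A where "A = (\<lambda>\<theta>. {xs. \<forall>j\<in>J. \<bar>real (count_list xs j) - real n * p \<theta> j\<bar> < real n * f j / (2 * real (K j))})"
  have S: "1 \<le> S" using L by (simp add: S_def)
  have fJ: "0 < f j" if "j \<in> J" for j using J(2)[OF that] by (intro f_pos) simp
  have finT: "finite T" unfolding T_def using J by (intro finite_PiE) auto
  have cardT: "real (card T) = (\<Prod>j\<in>J. real (K j))"
    unfolding T_def using J by (simp add: card_PiE)
  have Tne: "T \<noteq> {}" unfolding T_def using K by (auto simp: PiE_eq_empty_iff)
  have logT: "log 2 (real (card T)) = (\<Sum>j\<in>J. log 2 (real (K j)))"
    unfolding cardT using J K by (intro log_prod) (auto simp: Suc_le_eq)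
  have card1: "1 \<le> real (card T)"
    using finT Tne by (simp add: Suc_le_eq card_gt_0_iff)
  have theta: "1 \<le> \<theta> j \<and> \<theta> j \<le> K j" if "\<theta> \<in> T" "j \<in> J" for \<theta> j
    using that by (auto simp: T_def PiE_iff)
  have frac: "0 \<le> f j * real (\<theta> j) / real (K j)" "f j * real (\<theta> j) / real (K j) \<le> f j"
    if "\<theta> \<in> T" "j \<in> J" for \<theta> j
  proof -
    have "real (\<theta> j) \<le> real (K j)" using theta[OF that] by simp
    then show "0 \<le> f j * real (\<theta> j) / real (K j)" "f j * real (\<theta> j) / real (K j) \<le> f j"
      using fJ[OF that(2)] K[OF that(2)] by (auto simp: divide_le_eq mult_left_mono)
  qed
  \<comment> \<open>As \<open>J\<close> lies beyond \<open>L\<close>, its total envelope is below 1;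
    this makes the leftover mass nonnegative.\<close>
  have fJ_le: "(\<Sum>j\<in>J. f j) \<le> tail_sum f L"
  proof -
    have eq: "Suc (j - Suc L + L) = j" if "j \<in> J" for j using J(2)[OF that] by simp
    have "(\<Sum>j\<in>J. f j) = (\<Sum>i\<in>(\<lambda>j. j - Suc L) ` J. f (Suc (i + L)))"
      by (intro sum.reindex_bij_witness[where i = "\<lambda>i. Suc (i + L)" and j = "\<lambda>j. j - Suc L"])
         (use eq in auto)
    also have "\<dots> \<le> tail_sum f L"
      unfolding tail_sum_def using J
      by (intro sum_le_suminf summable_f_Suc) (auto intro: less_imp_le[OF f_pos])
    finally show ?thesis .
  qed
  have r: "0 \<le> r \<theta>" "r \<theta> \<le> 1" if "\<theta> \<in> T" for \<theta>
  proof -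
    have "(\<Sum>j\<in>J. f j * real (\<theta> j) / real (K j)) \<le> (\<Sum>j\<in>J. f j)"
      using frac[OF that] by (intro sum_mono)
    then show "0 \<le> r \<theta>" using fJ_le L by (simp add: r_def)
    show "r \<theta> \<le> 1" using frac[OF that] by (simp add: r_def sum_nonneg)
  qed
  have source: "is_source (p \<theta>)" and member: "p \<theta> \<in> envelope_class f" if t: "\<theta> \<in> T" for \<theta>
  proof -
    have nn: "0 \<le> p \<theta> j" for j
      using frac[OF t] r[OF t] S f_pos[of j] by (auto simp: p_def less_imp_le)
    have p0: "p \<theta> 0 = 0" using J(2)[of 0] by (auto simp: p_def)
    have "p \<theta> sums (\<Sum>j\<in>J \<union> {1..L}. p \<theta> j)"
      using J by (intro sums_finite) (auto simp: p_def)
    also have "(\<Sum>j\<in>J \<union> {1..L}. p \<theta> j) = (\<Sum>j\<in>J. p \<theta> j) + (\<Sum>j=1..L. p \<theta> j)"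
      using J by (intro sum.union_disjoint) (auto dest: J(2))
    also have "(\<Sum>j=1..L. p \<theta> j) = (\<Sum>j=1..L. r \<theta> * f j / S)"
      by (intro sum.cong) (auto simp: p_def dest!: J(2))
    also have "\<dots> = r \<theta> * S / S"
      unfolding S_def by (simp add: sum_distrib_left sum_divide_distrib)
    also have "(\<Sum>j\<in>J. p \<theta> j) + r \<theta> * S / S = 1"
      using S by (simp add: r_def p_def)
    finally have s1: "p \<theta> sums 1" .
    have le: "p \<theta> j \<le> f j" if "1 \<le> j" for j
    proof -
      have "r \<theta> * f j \<le> f j * S"
        using r[OF t] S f_pos[OF that] by (metis less_eq_real_def mult.commute mult_left_mono order_trans)
      then show ?thesis using frac[OF t] S f_pos[OF that] by (auto simp: p_def divide_le_eq)
    qed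
    show "is_source (p \<theta>)" "p \<theta> \<in> envelope_class f"
      using nn p0 s1 le by (auto simp: is_source_def envelope_class_def)
  qed
  \<comment> \<open>The means in coordinate \<open>j\<close> are integer multiples of the grid step,
    and a count closer than half a step to two of them forces them to coincide.\<close>
  have disj: "\<theta> = \<theta>'" if t: "\<theta> \<in> T" "\<theta>' \<in> T" and xs: "xs \<in> A \<theta>" "xs \<in> A \<theta>'" for \<theta> \<theta>' xs
  proof (rule PiE_ext[OF t[unfolded T_def]])
    fix j assume j: "j \<in> J"
    let ?u = "real n * f j / real (K j)"
    have u: "0 < ?u" using n fJ[OF j] K[OF j] by simp
    have near: "\<bar>a - b\<bar> < v" if "\<bar>w - a\<bar> < v / 2" "\<bar>w - b\<bar> < v / 2" for a b v w :: real
      using that by linarith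
    have eq: "real n * p t j = ?u * real (t j)" "real n * f j / (2 * real (K j)) = ?u / 2" for t
      using j by (simp_all add: p_def mult_ac)
    have "\<bar>real (count_list xs j) - ?u * real (\<theta> j)\<bar> < ?u / 2"
      "\<bar>real (count_list xs j) - ?u * real (\<theta>' j)\<bar> < ?u / 2"
      using xs[unfolded A_def mem_Collect_eq, THEN bspec, OF j] by (simp_all only: eq)
    then have "\<bar>?u * (real (\<theta> j) - real (\<theta>' j))\<bar> < ?u * 1"
      unfolding right_diff_distrib mult_1_right by (rule near)
    then have "\<bar>real (\<theta> j) - real (\<theta>' j)\<bar> < 1"
      using u by (simp only: abs_mult abs_of_pos mult_less_cancel_left_pos)
    then show "\<theta> j = \<theta>' j" by linarith
  qed
  \<comment> \<open>Union bound over the coordinates, each by Chebyshev with variance at most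
    \<open>real n * f j\<close>, uniformly in the grid point.\<close>
  have PA: "ennreal (1 - d) \<le> (\<integral>\<^sup>+xs. ennreal (iid_prob (p \<theta>) xs) * indicator (A \<theta>) xs \<partial>count_space (seqs n))"
    if t: "\<theta> \<in> T" for \<theta>
  proof -
    let ?M = "iid_pmf n (p \<theta>)"
    let ?B = "\<lambda>j. {xs. real n * f j / (2 * real (K j)) \<le> \<bar>real (count_list xs j) - real n * p \<theta> j\<bar>}"
    have "measure ?M (- A \<theta>) \<le> measure ?M (\<Union>j\<in>J. ?B j)"
      by (intro measure_pmf.finite_measure_mono) (auto simp: A_def not_less)
    also have "\<dots> \<le> (\<Sum>j\<in>J. measure ?M (?B j))"
      using J by (intro measure_pmf.finite_measure_subadditive_finite) auto
    also have "\<dots> \<le> (\<Sum>j\<in>J. 4 * (real (K j))\<^sup>2 / (real n * f j))"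
    proof (intro sum_mono)
      fix j assume j: "j \<in> J"
      note pos = fJ[OF j] K[OF j] n
      have "measure ?M (?B j) \<le> real n * p \<theta> j / (real n * f j / (2 * real (K j)))\<^sup>2"
        using count_list_deviation[of "real n * f j / (2 * real (K j))" n "embed_pmf (p \<theta>)" j] pos
        by (simp add: iid_pmf_def pmf_embed_source[OF source[OF t]])
      also have "\<dots> \<le> real n * f j / (real n * f j / (2 * real (K j)))\<^sup>2"
        using frac(2)[OF t j] j by (intro divide_right_mono mult_left_mono) (auto simp: p_def)
      also have "\<dots> = 4 * (real (K j))\<^sup>2 / (real n * f j)"
        using pos by (simp add: power2_eq_square field_simps)
      finally show "measure ?M (?B j) \<le> 4 * (real (K j))\<^sup>2 / (real n * f j)" .
    qed
    also have "\<dots> \<le> d" by (rule d)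
    finally have "1 - d \<le> measure ?M (A \<theta>)"
      using measure_pmf.prob_compl[of "A \<theta>" ?M] by (simp add: Compl_eq_Diff_UNIV)
    then have "ennreal (1 - d) \<le> emeasure ?M (A \<theta>)"
      by (simp add: measure_pmf.emeasure_eq_measure ennreal_leI)
    also have "\<dots> = (\<integral>\<^sup>+xs. ennreal (iid_prob (p \<theta>) xs) * indicator (A \<theta>) xs \<partial>count_space (seqs n))"
      by (simp add: nn_integral_iid[OF source[OF t]])
    finally show ?thesis .
  qed
  show ?thesis
    unfolding minimax_redundancy_def
  proof (rule INF_greatest)
    fix Q assume "Q \<in> {Q. is_coding_prob n Q}"
    then have Q: "\<And>xs. 0 \<le> Q xs" "(Q has_sum 1) (seqs n)" by (auto simp: is_coding_prob_def)
    have Q1: "(\<integral>\<^sup>+xs. ennreal (Q xs) \<partial>count_space (seqs n)) = 1"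
      using nn_integral_has_sum[of "seqs n" Q 1] Q by simp
    \<comment> \<open>The cells are disjoint, so their \<open>Q\<close>-masses add up to at most 1
      for any \<open>Q\<close>; the bad parameter is chosen after \<open>Q\<close>.\<close>
    have "(\<Sum>\<theta>\<in>T. \<integral>\<^sup>+xs. ennreal (Q xs) * indicator (A \<theta>) xs \<partial>count_space (seqs n))
       = (\<integral>\<^sup>+xs. (\<Sum>\<theta>\<in>T. ennreal (Q xs) * indicator (A \<theta>) xs) \<partial>count_space (seqs n))"
      by (subst nn_integral_sum) auto
    also have "\<dots> \<le> (\<integral>\<^sup>+xs. ennreal (Q xs) \<partial>count_space (seqs n))"
    proof (intro nn_integral_mono)
      fix xs
      show "(\<Sum>\<theta>\<in>T. ennreal (Q xs) * indicator (A \<theta>) xs) \<le> ennreal (Q xs)"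
      proof (cases "\<exists>\<theta>\<in>T. xs \<in> A \<theta>")
        case True
        then obtain \<theta> where \<theta>: "\<theta> \<in> T" "xs \<in> A \<theta>" by blast
        have "(\<Sum>\<theta>'\<in>T. ennreal (Q xs) * indicator (A \<theta>') xs) = (\<Sum>\<theta>'\<in>{\<theta>}. ennreal (Q xs) * indicator (A \<theta>') xs)"
          using finT \<theta> disj by (intro sum.mono_neutral_right) (auto simp: indicator_def)
        then show ?thesis by (simp add: \<theta>)
      qed (auto simp: indicator_def)
    qed
    also have "\<dots> = 1" by (rule Q1)
    finally obtain \<theta> where \<theta>: "\<theta> \<in> T" and
      Q\<theta>: "(\<integral>\<^sup>+xs. ennreal (Q xs) * indicator (A \<theta>) xs \<partial>count_space (seqs n)) \<le> ennreal (1 / real (card T))"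
      using exists_small_mass[OF finT Tne] by blast
    have "ereal ((1 - d) * log 2 (real (card T)) - 2 / ln 2) \<le> KL_div (seqs n) (iid_prob (p \<theta>)) Q"
      using Q Q1 Q\<theta> PA[OF \<theta>] card1 d iid_prob_nonneg[OF source[OF \<theta>]]
      by (intro KL_div_ge[where A = "A \<theta>"]) auto
    also have "\<dots> \<le> redundancy f n Q"
      unfolding redundancy_def by (intro SUP_upper member \<theta>)
    finally show "ereal ((1 - d) * (\<Sum>j\<in>J. log 2 (real (K j))) - 2 / ln 2) \<le> redundancy f n Q"
      by (simp add: logT)
  qed
qed

section \<open>Size of the grid and the constant 1/4\<close>

lemma log_nat_at_top: "filterlim (\<lambda>n. log 2 (real n)) at_top sequentially"
proof -
  have "filterlim (\<lambda>n. 1 / ln 2 * ln (real n)) at_top sequentially"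
    by (rule filterlim_tendsto_pos_mult_at_top[OF tendsto_const])
       (auto intro: filterlim_compose[OF ln_at_top filterlim_real_sequentially])
  then show ?thesis by (simp add: log_def)
qed

lemma log_log_over_log: "(\<lambda>n. log 2 (log 2 (real n)) / log 2 (real n)) \<longlonglongrightarrow> 0"
proof -
  have "((\<lambda>x::real. ln x / x / ln 2) \<longlongrightarrow> 0 / ln 2) at_top"
    by (intro tendsto_intros ln_x_over_x_tendsto_0) simp
  then have "((\<lambda>x::real. log 2 x / x) \<longlongrightarrow> 0) at_top"
    by (simp add: log_def field_simps)
  from filterlim_compose[OF this log_nat_at_top] show ?thesis .
qed

lemma minimax_redundancy_lower:
  "\<exists>e :: nat \<Rightarrow> real. e \<longlonglongrightarrow> 0 \<and> (\<forall>\<^sub>F n in sequentially.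
     ereal ((1/4 + e n) * threshold n * log 2 (real n)) \<le> minimax_redundancy f n)"
proof -
  obtain L where L: "1 \<le> L" "tail_sum f L < 1" "1 \<le> (\<Sum>j=1..L. f j)"
    using exists_absorbing_prefix by blast
  obtain c where c: "0 < c" and fc: "\<And>j. L < j \<Longrightarrow> c * survival (real (j - 1)) \<le> f j"
    using survival_to_f[OF L(1,2)] by blast
  obtain C where C: "0 < C" and thr: "\<forall>\<^sub>F n in sequentially. threshold n \<le> C * log 2 (real n)"
    using threshold_le_log by blast
  define m where "m = threshold"
  define l where "l n = log 2 (real n)" for n :: nat
  \<comment> \<open>Bits lost per coordinate: \<open>\<bar>log 2 c\<bar>\<close> for passing from
    the tail to \<open>f\<close>, 1 for rounding the number of grid points down,
    \<open>log 2 (l n)\<close> for coarsening the grid by the factor \<open>l n\<close>.\<close>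
  define D where "D n = \<bar>log 2 c\<bar> + 1 + log 2 (l n)" for n
  \<comment> \<open>A lower bound for the logarithm of the grid size: the triangular sum of
    \<open>(1 - (j - 1) / m n) * l n / 2\<close> without the first \<open>L\<close> coordinates,
    minus the losses.\<close>
  define Y where "Y n = l n * (m n - 1 - 2 * real L) / 4 - m n * D n" for n
  \<comment> \<open>Failure probability: at most \<open>m n \<le> C * l n\<close> coordinates, each
    contributing \<open>4 / (l n)\<^sup>2\<close>.\<close>
  define d where "d n = 4 * C * inverse (l n)" for n
  \<comment> \<open>Solved so that \<open>(1/4 + e n) * m n * l n\<close> is exactly the bound
    obtained from \<open>Y\<close> and \<open>d\<close>.\<close>
  define e where "e n = ((1 - d n) * Y n - 2 / ln 2) / (m n * l n) - 1/4" for n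
  have l_lim: "filterlim l at_top sequentially" unfolding l_def by (rule log_nat_at_top)
  have m_lim: "filterlim m at_top sequentially" unfolding m_def by (rule threshold_at_top)
  have ev1: "\<forall>\<^sub>F n in sequentially. real L + 1 \<le> m n \<and> 1 \<le> l n \<and> 4 * C \<le> l n \<and> 2 \<le> n \<and> m n \<le> C * l n"
    using m_lim l_lim thr unfolding m_def l_def
    by (intro eventually_conj) (auto simp: filterlim_at_top intro: eventually_ge_at_top)
  have "e \<longlonglongrightarrow> 0"
  proof -
    have Y_split: "(y * (x - 1 - 2 * a) / 4 - x * (b + z)) / (x * y)
       = (1 - (1 + 2 * a) * inverse x) / 4 - (b * inverse y + z / y)" if "x \<noteq> 0" "y \<noteq> 0" for x y z a b :: real
      using that by (simp add: field_simps)
    have e_split: "(x * y - b) / z - a = x * (y / z) - b * inverse z - a" for x y z a b :: real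
      by (simp add: divide_inverse algebra_simps)
    have ml: "filterlim (\<lambda>n. m n * l n) at_top sequentially"
      by (rule filterlim_at_top_mult_at_top[OF m_lim l_lim])
    have inv: "(\<lambda>n. inverse (m n)) \<longlonglongrightarrow> 0" "(\<lambda>n. inverse (l n)) \<longlonglongrightarrow> 0" "(\<lambda>n. inverse (m n * l n)) \<longlonglongrightarrow> 0"
      by (rule m_lim[THEN tendsto_inverse_0_at_top] l_lim[THEN tendsto_inverse_0_at_top]
          ml[THEN tendsto_inverse_0_at_top])+
    have "(\<lambda>n. (1 - 4 * C * inverse (l n)) *
        ((1 - (1 + 2 * real L) * inverse (m n)) / 4 - ((\<bar>log 2 c\<bar> + 1) * inverse (l n) + log 2 (l n) / l n))
        - 2 / ln 2 * inverse (m n * l n) - 1/4) \<longlonglongrightarrow>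
        (1 - 4 * C * 0) * ((1 - (1 + 2 * real L) * 0) / 4 - ((\<bar>log 2 c\<bar> + 1) * 0 + 0)) - 2 / ln 2 * 0 - 1/4"
      by (intro tendsto_intros inv log_log_over_log[folded l_def]) simp
    moreover have "\<forall>\<^sub>F n in sequentially. (1 - 4 * C * inverse (l n)) *
        ((1 - (1 + 2 * real L) * inverse (m n)) / 4 - ((\<bar>log 2 c\<bar> + 1) * inverse (l n) + log 2 (l n) / l n))
        - 2 / ln 2 * inverse (m n * l n) - 1/4 = e n"
      using ev1
    proof eventually_elim
      case (elim n)
      then have pos: "m n \<noteq> 0" "l n \<noteq> 0" by auto
      have "Y n / (m n * l n) = (1 - (1 + 2 * real L) * inverse (m n)) / 4 - ((\<bar>log 2 c\<bar> + 1) * inverse (l n) + log 2 (l n) / l n)"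
        unfolding Y_def D_def by (rule Y_split[OF pos])
      moreover have "e n = (1 - d n) * (Y n / (m n * l n)) - 2 / ln 2 * inverse (m n * l n) - 1/4"
        unfolding e_def by (rule e_split)
      ultimately show ?case by (simp only: d_def)
    qed
    ultimately show ?thesis by (simp add: tendsto_cong)
  qed
  moreover have "\<forall>\<^sub>F n in sequentially. ereal ((1/4 + e n) * m n * l n) \<le> minimax_redundancy f n"
    using ev1
  proof eventually_elim
    case (elim n)
    define N where "N = nat \<lfloor>m n\<rfloor>"
    \<comment> \<open>Coordinates that keep at least one grid point after coarsening. For the
      omitted ones \<open>h j\<close> is nonpositive, so dropping them does not decrease the
      sum.\<close>
    define J where "J = {j\<in>{L<..N}. l n \<le> sqrt (real n * f j)}"
    define K where "K j = nat \<lfloor>sqrt (real n * f j) / l n\<rfloor>" for j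
    define h where "h j = (1 - (real j - 1) / m n) * l n / 2 - D n" for j :: nat
    have n: "1 \<le> n" "0 < real n" and l: "1 \<le> l n" and m: "1 \<le> m n" using elim by auto
    have N: "real N \<le> m n" "m n - 1 \<le> real N" "L \<le> N" using elim by (auto simp: N_def) linarith+
    have nf: "0 < real n * f j" if "L < j" for j using f_pos[of j] that n by simp
    have K_ge: "1 \<le> sqrt (real n * f j) / l n" if "j \<in> J" for j
      using that l by (auto simp: J_def)
    have K1: "1 \<le> K j" if "j \<in> J" for j using K_ge[OF that] by (simp add: K_def le_nat_iff)
    have K_le: "real (K j) \<le> sqrt (real n * f j) / l n" if "j \<in> J" for j
      using K_ge[OF that] by (simp add: K_def)
    have half_le_floor: "x / 2 \<le> real_of_int \<lfloor>x\<rfloor>" if "1 \<le> x" for x :: real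
    proof -
      have "1 \<le> \<lfloor>x\<rfloor>" using that by simp
      then have "1 \<le> real_of_int \<lfloor>x\<rfloor>" by linarith
      then show ?thesis using real_of_int_floor_gt_diff_one[of x] by linarith
    qed
    have D: "0 \<le> D n" using l by (simp add: D_def)
    have h_le: "h j \<le> log 2 (sqrt (real n * f j) / l n) - 1" if j: "L < j" "j \<le> N" for j
    proof -
      have jm: "real j \<le> m n" using j N by simp
      \<comment> \<open>The chord to the threshold is evaluated at \<open>j - 1\<close>, since
        \<open>f j\<close> is compared with the tail there. The nonnegative term with
        \<open>log 2 (m n)\<close> is then discarded.\<close>
      have "(real j - 1) / m n * log_survival (m n) \<le> log_survival ((real j - 1) / m n * m n)"
        using jm j m by (intro log_survival_scale) auto
      also have "(real j - 1) / m n * m n = real (j - 1)" using m j by (simp add: of_nat_diff)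
      also have "log_survival (m n) = log 2 (m n) - l n"
        using threshold[OF n(1)] m n by (simp add: m_def l_def log_survival_def log_divide)
      finally have "(real j - 1) / m n * (log 2 (m n) - l n) \<le> log_survival (real (j - 1))" .
      moreover have "0 \<le> (real j - 1) / m n * log 2 (m n)"
        using m j by (intro mult_nonneg_nonneg divide_nonneg_nonneg) auto
      ultimately have *: "- ((real j - 1) / m n * l n) \<le> log_survival (real (j - 1))"
        by (simp only: right_diff_distrib)
      have "log 2 c + log_survival (real (j - 1)) = log 2 (c * survival (real (j - 1)))"
        using c survival_pos[of "real (j - 1)"] by (simp add: log_survival_def log_mult)
      also have "\<dots> \<le> log 2 (f j)"
        using fc[OF j(1)] c survival_pos[of "real (j - 1)"] f_pos[of j] j by (simp add: mult_pos_pos)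
      finally have "log 2 c + log_survival (real (j - 1)) \<le> log 2 (f j)" .
      moreover have "log 2 (sqrt (real n * f j) / l n) = (l n + log 2 (f j)) / 2 - log 2 (l n)"
      proof -
        have "log 2 (sqrt (real n * f j)) = log 2 (real n * f j) / 2"
          using nf[OF j(1)] by (simp add: log_def ln_sqrt)
        also have "log 2 (real n * f j) = l n + log 2 (f j)"
          using n f_pos[of j] j by (simp add: l_def log_mult)
        finally show ?thesis
          using nf[OF j(1)] l by (subst log_divide) auto
      qed
      moreover have "\<bar>log 2 c\<bar> \<ge> - (log 2 c) / 2" by simp
      ultimately show ?thesis using * by (simp add: h_def D_def field_simps)
    qed
    have "Y n \<le> (\<Sum>j\<in>{L<..N}. h j)"
    proof -
      have "(\<Sum>j\<in>{L<..N}. (real j - 1)) \<le> (\<Sum>j=1..N. (real j - 1))"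
        by (intro sum_mono2) auto
      also have "\<dots> = real N * (real N - 1) / 2" by (induction N) (auto simp: field_simps)
      also have "\<dots> \<le> m n * real N / 2"
        using N mult_right_mono[of "real N - 1" "m n" "real N"] by (simp add: mult.commute)
      finally have "(\<Sum>j\<in>{L<..N}. (real j - 1)) / m n \<le> real N / 2"
        using m by (simp add: field_simps)
      then have "real N / 2 - real L \<le> (\<Sum>j\<in>{L<..N}. 1 - (real j - 1) / m n)"
        unfolding sum_subtractf[where f = "\<lambda>_. 1"] sum_divide_distrib[symmetric]
        using N by (simp add: of_nat_diff del: sum_subtractf)
      then have "(real N / 2 - real L) * (l n / 2) \<le> (\<Sum>j\<in>{L<..N}. 1 - (real j - 1) / m n) * (l n / 2)"
        using l by (intro mult_right_mono) auto
      also have "\<dots> = (\<Sum>j\<in>{L<..N}. (1 - (real j - 1) / m n) * l n / 2)"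
        by (simp add: sum_distrib_right)
      finally have 1: "(real N / 2 - real L) * (l n / 2) \<le> (\<Sum>j\<in>{L<..N}. (1 - (real j - 1) / m n) * l n / 2)" .
      have 2: "(\<Sum>j\<in>{L<..N}. D n) \<le> m n * D n"
        using N D by (auto intro!: mult_right_mono simp: of_nat_diff)
      have 3: "l n * (m n - 1 - 2 * real L) / 4 \<le> (real N / 2 - real L) * (l n / 2)"
        using mult_left_mono[of "m n - 1" "real N" "l n"] N l by (simp add: field_simps)
      show ?thesis using 1 2 3 by (simp add: Y_def h_def sum_subtractf)
    qed
    also have "\<dots> \<le> (\<Sum>j\<in>J. h j)"
    proof -
      have "h j \<le> 0" if "j \<in> {L<..N} - J" for j
      proof -
        have "0 < sqrt (real n * f j)" using nf that by auto
        then have "log 2 (sqrt (real n * f j) / l n) < 0"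
          using that l by (auto simp: J_def not_le log_less_zero_cancel_iff)
        then show ?thesis using h_le[of j] that by auto
      qed
      then have "(\<Sum>j\<in>{L<..N} - J. h j) \<le> 0" by (rule sum_nonpos)
      moreover have "(\<Sum>j\<in>{L<..N}. h j) = (\<Sum>j\<in>{L<..N} - J. h j) + (\<Sum>j\<in>J. h j)"
        by (intro sum.subset_diff) (auto simp: J_def)
      ultimately show ?thesis by simp
    qed
    also have "\<dots> \<le> (\<Sum>j\<in>J. log 2 (real (K j)))"
    proof (intro sum_mono)
      fix j assume j: "j \<in> J"
      have "sqrt (real n * f j) / l n / 2 \<le> real (K j)"
        using K_ge[OF j] half_le_floor[OF K_ge[OF j]] by (simp add: K_def)
      then have "log 2 (sqrt (real n * f j) / l n / 2) \<le> log 2 (real (K j))"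
        using K_ge[OF j] by (intro log_mono) auto
      moreover have "log 2 (sqrt (real n * f j) / l n / 2) = log 2 (sqrt (real n * f j) / l n) - 1"
        using K_ge[OF j] by (subst log_divide) auto
      ultimately show "h j \<le> log 2 (real (K j))"
        using h_le[of j] j by (auto simp: J_def)
    qed
    finally have Y: "Y n \<le> (\<Sum>j\<in>J. log 2 (real (K j)))" .
    have "(\<Sum>j\<in>J. 4 * (real (K j))\<^sup>2 / (real n * f j)) \<le> (\<Sum>j\<in>J. 4 / (l n)\<^sup>2)"
    proof (intro sum_mono)
      fix j assume j: "j \<in> J"
      then have nfj: "0 < real n * f j" using nf by (auto simp: J_def)
      have "(real (K j))\<^sup>2 \<le> (sqrt (real n * f j) / l n)\<^sup>2"
        using K_le[OF j] by (intro power_mono) auto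
      also have "\<dots> = real n * f j / (l n)\<^sup>2" using nfj by (simp add: power_divide)
      finally have "4 * (real (K j))\<^sup>2 \<le> 4 / (l n)\<^sup>2 * (real n * f j)" by simp
      then show "4 * (real (K j))\<^sup>2 / (real n * f j) \<le> 4 / (l n)\<^sup>2"
        using nfj by (simp only: pos_divide_le_eq)
    qed
    also have "\<dots> = real (card J) * (4 / (l n)\<^sup>2)" by simp
    also have "\<dots> \<le> (C * l n) * (4 / (l n)\<^sup>2)"
    proof -
      have "card J \<le> card {L<..N}" unfolding J_def by (intro card_mono) auto
      then have "real (card J) \<le> real N" by simp
      then have "real (card J) \<le> C * l n" using N elim by linarith
      then show ?thesis by (intro mult_right_mono) auto
    qed
    also have "\<dots> = d n" using l by (simp add: d_def power2_eq_square divide_simps)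
    finally have d: "(\<Sum>j\<in>J. 4 * (real (K j))\<^sup>2 / (real n * f j)) \<le> d n" .
    have d1: "d n \<le> 1" using elim by (simp add: d_def divide_inverse[symmetric])
    have "(1/4 + e n) * m n * l n = (1 - d n) * Y n - 2 / ln 2"
      using m l by (simp add: e_def)
    also have "\<dots> \<le> (1 - d n) * (\<Sum>j\<in>J. log 2 (real (K j))) - 2 / ln 2"
      using Y d1 by (intro diff_right_mono mult_left_mono) auto
    finally have "ereal ((1/4 + e n) * m n * l n) \<le> ereal ((1 - d n) * (\<Sum>j\<in>J. log 2 (real (K j))) - 2 / ln 2)"
      by simp
    also have "\<dots> \<le> minimax_redundancy f n"
      using L n d d1 K1 by (intro minimax_redundancy_ge[where L = L]) (auto simp: J_def)
    finally show ?case .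
  qed
  ultimately show ?thesis unfolding m_def l_def by blast
qed

end

section \<open>The ETAC code as a coding probability\<close>

lemma sum_dyadic_blocks:
  fixes h :: "nat \<Rightarrow> real"
  shows "(\<Sum>k\<in>{1..<2 ^ L}. h k) = (\<Sum>l<L. \<Sum>k\<in>{2 ^ l..<2 ^ Suc l}. h k)"
proof (induction L)
  case (Suc L)
  have "(\<Sum>k\<in>{1..<2 ^ Suc L}. h k) = (\<Sum>k\<in>{1..<2 ^ L}. h k) + (\<Sum>k\<in>{2 ^ L..<2 ^ Suc L}. h k)"
    by (intro sum.atLeastLessThan_concat[symmetric]) auto
  then show ?case using Suc by simp
qed simp

lemma floor_log2: "2 ^ l \<le> k \<Longrightarrow> k < 2 ^ Suc l \<Longrightarrow> \<lfloor>log 2 (real k)\<rfloor> = int l"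
  using floor_log_nat_eq_if[of 2 l k] by simp

lemma elias_len_block:
  assumes "2 ^ l \<le> k" "k < 2 ^ Suc l"
  shows "elias_len k = 1 + l + 2 * nat \<lfloor>log 2 (real (Suc l))\<rfloor>"
  using floor_log2[OF assms] by (simp add: elias_len_def add.commute)

lemma elias_len_mono:
  assumes "1 \<le> k" "k \<le> l"
  shows "elias_len k \<le> elias_len l"
proof -
  have *: "\<lfloor>log 2 (real k)\<rfloor> \<le> \<lfloor>log 2 (real l)\<rfloor>" using assms by (intro floor_mono) simp
  moreover have "0 \<le> \<lfloor>log 2 (real k)\<rfloor>" using assms by simp
  ultimately have "\<lfloor>log 2 (1 + real_of_int \<lfloor>log 2 (real k)\<rfloor>)\<rfloor> \<le> \<lfloor>log 2 (1 + real_of_int \<lfloor>log 2 (real l)\<rfloor>)\<rfloor>"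
    by (intro floor_mono log_mono) linarith+
  then show ?thesis unfolding elias_len_def using * by (intro add_mono mult_left_mono nat_mono) auto
qed

lemma elias_len_le:
  assumes "1 \<le> k"
  shows "real (elias_len k) \<le> 1 + log 2 (real k) + 2 * log 2 (1 + log 2 (real k))"
proof -
  let ?a = "\<lfloor>log 2 (real k)\<rfloor>"
  have a: "0 \<le> ?a" "real_of_int ?a \<le> log 2 (real k)" using assms by auto
  then have "1 \<le> 1 + real_of_int ?a" by linarith
  then have b: "0 \<le> log 2 (1 + real_of_int ?a)" by (subst zero_le_log_cancel_iff) linarith+
  have "real_of_int \<lfloor>log 2 (1 + real_of_int ?a)\<rfloor> \<le> log 2 (1 + real_of_int ?a)" by simp
  also have "\<dots> \<le> log 2 (1 + log 2 (real k))" using a by (intro log_mono) linarith+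
  finally have "real_of_int \<lfloor>log 2 (1 + real_of_int ?a)\<rfloor> \<le> log 2 (1 + log 2 (real k))" .
  moreover have "real (elias_len k) = 1 + real_of_int ?a + 2 * real_of_int \<lfloor>log 2 (1 + real_of_int ?a)\<rfloor>"
    using a b by (simp add: elias_len_def)
  ultimately show ?thesis using a(2) by linarith
qed

text \<open>Dyadic summation, used twice. The \<open>2 ^ l\<close> integers of one block share a
  codeword length and together weigh \<open>g (Suc l) / 2\<close>; the function \<open>g\<close> is
  again constant on dyadic blocks, whose sums \<open>(1/2) ^ r\<close> add up to at most 2.\<close>

lemma elias_kraft: "(\<Sum>k. ennreal (2 powr - real (elias_len (Suc k)))) \<le> 1"
proof -
  define g where "g i = (1/4 :: real) ^ nat \<lfloor>log 2 (real i)\<rfloor>" for i :: nat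
  define h where "h k = 2 powr - real (elias_len k)" for k
  have block: "(\<Sum>i\<in>{2 ^ r..<2 ^ Suc r}. g i) = (1/2) ^ r" for r
  proof -
    have "(\<Sum>i\<in>{2 ^ r..<2 ^ Suc r}. g i) = (\<Sum>i\<in>{2 ^ r..<2 ^ Suc r :: nat}. (1/4 :: real) ^ r)"
    proof (intro sum.cong refl)
      fix i :: nat assume "i \<in> {2 ^ r..<2 ^ Suc r}"
      then have "\<lfloor>log 2 (real i)\<rfloor> = int r" by (intro floor_log2) auto
      then show "g i = (1/4) ^ r" by (simp add: g_def)
    qed
    also have "\<dots> = 2 ^ r * (1/4) ^ r" by simp
    finally show ?thesis by (simp flip: power_mult_distrib)
  qed
  have g_le: "(\<Sum>i\<in>{1..<2 ^ R}. g i) \<le> 2" for R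
  proof -
    have "(\<Sum>i\<in>{1..<2 ^ R}. g i) = (\<Sum>r<R. (1/2) ^ r)"
      unfolding sum_dyadic_blocks block ..
    also have "\<dots> = 2 - 2 * (1/2) ^ R" by (subst geometric_sum) (auto simp: field_simps)
    finally show ?thesis by simp
  qed
  have h_block: "(\<Sum>k\<in>{2 ^ l..<2 ^ Suc l}. h k) = g (Suc l) / 2" for l
  proof -
    let ?q = "nat \<lfloor>log 2 (real (Suc l))\<rfloor>"
    have "(\<Sum>k\<in>{2 ^ l..<2 ^ Suc l}. h k) = (\<Sum>k\<in>{2 ^ l..<2 ^ Suc l :: nat}. 2 powr - real (1 + l + 2 * ?q))"
    proof (intro sum.cong refl)
      fix k :: nat assume "k \<in> {2 ^ l..<2 ^ Suc l}"
      then have "elias_len k = 1 + l + 2 * ?q" by (intro elias_len_block) auto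
      then show "h k = 2 powr - real (1 + l + 2 * ?q)" by (simp only: h_def)
    qed
    also have "\<dots> = 2 ^ l * 2 powr - real (1 + l + 2 * ?q)" by simp
    also have "2 powr - real (1 + l + 2 * ?q) = inverse (2 ^ (1 + l + 2 * ?q))"
      by (simp only: powr_minus powr_realpow zero_less_numeral)
    also have "2 ^ l * inverse (2 ^ (1 + l + 2 * ?q)) = inverse (4 ^ ?q) / (2::real)"
      by (simp add: power_add power_mult)
    finally show ?thesis by (simp add: g_def power_divide inverse_eq_divide)
  qed
  have "(\<Sum>k<n. h (Suc k)) \<le> 1" for n
  proof -
    have sub: "{1..n} \<subseteq> {1..<2 ^ n}" by (auto intro: le_less_trans[OF _ less_exp])
    have "(\<Sum>k<n. h (Suc k)) = (\<Sum>k\<in>{1..n}. h k)"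
      by (intro sum.reindex_bij_witness[where i = "\<lambda>k. k - 1" and j = Suc]) auto
    also have "\<dots> \<le> (\<Sum>k\<in>{1..<2 ^ n}. h k)"
      using sub by (intro sum_mono2) (auto simp: h_def)
    also have "\<dots> = (\<Sum>l<n. g (Suc l) / 2)" unfolding sum_dyadic_blocks h_block ..
    also have "\<dots> = (\<Sum>i\<in>{1..n}. g i) / 2"
      unfolding sum_divide_distrib
      by (intro sum.reindex_bij_witness[where i = "\<lambda>k. k - 1" and j = Suc]) auto
    also have "\<dots> \<le> (\<Sum>i\<in>{1..<2 ^ n}. g i) / 2"
      using sub by (intro divide_right_mono sum_mono2) (auto simp: g_def)
    finally show ?thesis using g_le[of n] by simp
  qed
  then have "(\<Sum>k<n. ennreal (h (Suc k))) \<le> 1" for n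
    by (subst sum_ennreal) (auto simp: h_def)
  then show ?thesis unfolding suminf_eq_SUP h_def by (intro SUP_least)
qed

section \<open>The adaptive threshold through counts of exceedances\<close>

definition count_above :: "nat list \<Rightarrow> nat \<Rightarrow> nat" where
  "count_above xs k = length (filter (\<lambda>x. k < x) xs)"

lemma count_above_append: "count_above (xs @ ys) k = count_above xs k + count_above ys k"
  by (simp add: count_above_def)

lemma count_above_le_length: "count_above xs k \<le> length xs"
  by (simp add: count_above_def)

lemma count_above_antimono: "k \<le> l \<Longrightarrow> count_above xs l \<le> count_above xs k"
  unfolding count_above_def by (induction xs) auto

lemma count_above_mset: "mset xs = mset ys \<Longrightarrow> count_above xs k = count_above ys k"
  unfolding count_above_def by (metis mset_filter size_mset)

lemma count_list_le_count_above: "k < y \<Longrightarrow> count_list xs y \<le> count_above xs k"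
  unfolding count_above_def by (induction xs) auto

text \<open>In a decreasing list the entries above \<open>k\<close> form an initial segment, so the
  length of that segment decides whether the entry with index \<open>k - 1\<close> belongs to
  it.\<close>

lemma order_statistic_le_iff:
  assumes "1 \<le> k" "k \<le> length xs"
  shows "rev (sort xs) ! (k - 1) \<le> k \<longleftrightarrow> count_above xs k < k"
proof -
  define ys where "ys = rev (sort xs)"
  have len: "length ys = length xs" by (simp add: ys_def)
  have desc: "ys ! b \<le> ys ! a" if "a \<le> b" "b < length ys" for a b
    using that unfolding ys_def by (simp add: rev_nth sorted_nth_mono)
  have "count_above xs k = count_above ys k" by (intro count_above_mset) (simp add: ys_def)
  also have "\<dots> = card {i. i < length ys \<and> k < ys ! i}"
    unfolding count_above_def by (rule length_filter_conv_card)
  finally have c: "count_above xs k = card {i. i < length ys \<and> k < ys ! i}" .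
  show ?thesis
    unfolding ys_def[symmetric] c
  proof
    assume le: "ys ! (k - 1) \<le> k"
    have "{i. i < length ys \<and> k < ys ! i} \<subseteq> {..<k - 1}"
    proof
      fix i assume "i \<in> {i. i < length ys \<and> k < ys ! i}"
      then show "i \<in> {..<k - 1}" using desc[of "k - 1" i] le by (auto simp: not_le[symmetric])
    qed
    then have "card {i. i < length ys \<and> k < ys ! i} \<le> card {..<k - 1}" by (intro card_mono) auto
    then show "card {i. i < length ys \<and> k < ys ! i} < k" using assms by simp
  next
    assume lt: "card {i. i < length ys \<and> k < ys ! i} < k"
    show "ys ! (k - 1) \<le> k"
    proof (rule ccontr)
      assume gt: "\<not> ?thesis"
      have "{..<k} \<subseteq> {i. i < length ys \<and> k < ys ! i}"
      proof
        fix i assume "i \<in> {..<k}"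
        then have "i \<le> k - 1" "k - 1 < length ys" using assms len by auto
        then show "i \<in> {i. i < length ys \<and> k < ys ! i}" using desc[of i "k - 1"] gt by simp
      qed
      then have "card {..<k} \<le> card {i. i < length ys \<and> k < ys ! i}" by (intro card_mono) auto
      then show False using lt by simp
    qed
  qed
qed

text \<open>Unlike sorted lists, counts of exceedances are additive under concatenation and
  invariant under permutation; the censoring arguments rely on both.\<close>

lemma etac_M_alt:
  "etac_M xs = (if \<exists>k. 1 \<le> k \<and> k \<le> length xs \<and> count_above xs k < k
     then (LEAST k. 1 \<le> k \<and> k \<le> length xs \<and> count_above xs k < k) else length xs)"
proof -
  have *: "(1 \<le> k \<and> k \<le> length xs \<and> rev (sort xs) ! (k - 1) \<le> k)
     = (1 \<le> k \<and> k \<le> length xs \<and> count_above xs k < k)" for k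
    using order_statistic_le_iff[of k xs] by blast
  let ?P = "\<lambda>k. 1 \<le> k \<and> k \<le> length xs \<and> count_above xs k < k"
  show ?thesis
  proof (cases "\<exists>k. ?P k")
    case True
    then have "(LEAST k. ?P k) \<le> length xs" using LeastI_ex[OF True] by blast
    then show ?thesis unfolding etac_M_def Let_def * if_P[OF True] by (rule min_absorb2)
  next
    case False
    show ?thesis unfolding etac_M_def Let_def * if_not_P[OF False] by (rule refl)
  qed
qed

text \<open>The third inequality is not strict because of the fallback to the length, where only the
  trivial bound on the count remains.\<close>

lemma etac_M_bounds:
  assumes "xs \<noteq> []"
  shows "1 \<le> etac_M xs" "etac_M xs \<le> length xs" "count_above xs (etac_M xs) \<le> etac_M xs"
proof -
  let ?P = "\<lambda>k. 1 \<le> k \<and> k \<le> length xs \<and> count_above xs k < k"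
  have "1 \<le> etac_M xs \<and> etac_M xs \<le> length xs \<and> count_above xs (etac_M xs) \<le> etac_M xs"
  proof (cases "\<exists>k. ?P k")
    case True
    then show ?thesis using LeastI_ex[OF True] unfolding etac_M_alt by simp
  next
    case False
    have "etac_M xs = length xs" unfolding etac_M_alt if_not_P[OF False] by (rule refl)
    then show ?thesis using assms count_above_le_length[of xs] by (simp add: Suc_le_eq)
  qed
  then show "1 \<le> etac_M xs" "etac_M xs \<le> length xs" "count_above xs (etac_M xs) \<le> etac_M xs" by auto
qed

text \<open>The number \<open>?k\<close> exceeds the count of symbols above \<open>V\<close>, hence
  also the count above itself, so it is a candidate for the minimum. If it is longer than the word,
  the length bounds the threshold instead.\<close>

lemma etac_M_le: "etac_M xs \<le> V + count_above xs V + 1"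
proof -
  let ?k = "V + count_above xs V + 1"
  let ?P = "\<lambda>k. 1 \<le> k \<and> k \<le> length xs \<and> count_above xs k < k"
  show ?thesis
  proof (cases "?k \<le> length xs")
    case True
    then have "?P ?k" using count_above_antimono[of V ?k xs] by simp
    then show ?thesis using Least_le[of ?P ?k] unfolding etac_M_alt by auto
  next
    case False
    then show ?thesis
    proof (cases "xs = []")
      case False
      then show ?thesis using etac_M_bounds(2)[of xs] \<open>\<not> ?k \<le> length xs\<close> by simp
    qed (simp add: etac_M_alt)
  qed
qed

section \<open>Kraft's inequality for the interleaved code\<close>

definition etac_cond :: "nat list \<Rightarrow> nat \<Rightarrow> real" where
  "etac_cond ps y = (if y > etac_M ps
     then etac_pred ps 0 * 2 powr (- real (elias_len (y - etac_M ps + 1))) else etac_pred ps y)"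

text \<open>The weight without the terminating 0. It is a product of conditional weights, so it can
  be summed from the last symbol backwards.\<close>

definition etac_prefix :: "nat list \<Rightarrow> real" where
  "etac_prefix xs = 2 powr (- real (elias_len (hd xs))) * (\<Prod>i\<in>{1..<length xs}. etac_cond (take i xs) (xs ! i))"

lemma etac_weight_eq: "xs \<noteq> [] \<Longrightarrow> etac_weight xs = etac_prefix xs * etac_pred xs 0"
  by (cases xs) (simp_all add: etac_weight_def etac_prefix_def etac_cond_def Let_def)

lemma etac_prefix_snoc:
  assumes "xs \<noteq> []"
  shows "etac_prefix (xs @ [y]) = etac_prefix xs * etac_cond xs y"
proof -
  have "(\<Prod>i\<in>{1..<length xs}. etac_cond (take i (xs @ [y])) ((xs @ [y]) ! i))
      = (\<Prod>i\<in>{1..<length xs}. etac_cond (take i xs) (xs ! i))"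
    by (intro prod.cong) (auto simp: nth_append)
  moreover have "1 \<le> length xs" using assms by (simp add: Suc_le_eq)
  ultimately show ?thesis
    using assms by (simp add: etac_prefix_def prod.atLeastLessThan_Suc nth_append)
qed

lemma etac_pred_pos: "j \<le> etac_M ps \<Longrightarrow> 0 < etac_pred ps j"
  by (auto simp: etac_pred_def intro!: divide_pos_pos add_nonneg_pos)

lemma etac_pred_0_le_1: "xs \<noteq> [] \<Longrightarrow> etac_pred xs 0 \<le> 1"
proof -
  assume "xs \<noteq> []"
  then have "1 \<le> real (length xs)" by (simp add: Suc_le_eq)
  then show ?thesis by (simp add: etac_pred_def divide_le_eq add_divide_distrib)
qed

lemma etac_cond_pos: "0 < etac_cond ps y"
  using etac_pred_pos by (simp add: etac_cond_def)

lemma etac_prefix_pos: "0 < etac_prefix xs"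
  unfolding etac_prefix_def by (intro mult_pos_pos prod_pos) (auto intro: etac_cond_pos)

lemma etac_weight_pos: "xs \<noteq> [] \<Longrightarrow> 0 < etac_weight xs"
  by (simp add: etac_weight_eq etac_prefix_pos etac_pred_pos)

lemma sum_count_list_le: "(\<Sum>j<M. count_list xs (Suc j)) \<le> length xs"
proof (induction xs)
  case (Cons x xs)
  have "(\<Sum>j<M. count_list (x # xs) (Suc j)) = (\<Sum>j<M. count_list xs (Suc j)) + (\<Sum>j<M. if Suc j = x then 1 else 0)"
    unfolding sum.distrib[symmetric] by (intro sum.cong) auto
  also have "(\<Sum>j<M. if Suc j = x then 1 else 0 :: nat) \<le> 1"
  proof (cases x)
    case (Suc x')
    then have "(\<Sum>j<M. if Suc j = x then 1 else 0 :: nat) = (\<Sum>j<M. if j = x' then 1 else 0)" by simp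
    then show ?thesis by simp
  qed simp
  finally show ?case using Cons by simp
qed simp

text \<open>The add-1/2 values on \<open>{0..?M}\<close> sum to at most 1, since the counts of
  \<open>1..?M\<close> sum to at most the length and 0 counts as unseen. The share of 0 is then
  divided among the censored symbols by the Elias code.\<close>

lemma etac_cond_kraft:
  assumes "ps \<noteq> []"
  shows "(\<Sum>k. ennreal (etac_cond ps (Suc k))) \<le> 1"
proof -
  let ?M = "etac_M ps" and ?i = "length ps"
  \<comment> \<open>A censored \<open>y\<close> is sent as \<open>y - ?M + 1\<close>, which is at
    least 2, so the codeword of 1 drops out of the sum.\<close>
  have elias_tail: "(\<Sum>k. ennreal (2 powr - real (elias_len (Suc (Suc k))))) \<le> 1"
  proof -
    have "(\<Sum>k. ennreal (2 powr - real (elias_len (Suc k))))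
      = (\<Sum>k. ennreal (2 powr - real (elias_len (Suc (k + 1))))) + (\<Sum>k<1. ennreal (2 powr - real (elias_len (Suc k))))"
      by (rule suminf_offset) simp
    then have "(\<Sum>k. ennreal (2 powr - real (elias_len (Suc (k + 1)))))
        \<le> (\<Sum>k. ennreal (2 powr - real (elias_len (Suc k))))"
      by (simp only: le_iff_add) blast
    also note elias_kraft
    finally show ?thesis by simp
  qed
  have "(\<Sum>k. ennreal (etac_cond ps (Suc k)))
      = (\<Sum>k. ennreal (etac_cond ps (Suc (k + ?M)))) + (\<Sum>k<?M. ennreal (etac_cond ps (Suc k)))"
    by (rule suminf_offset) simp
  also have "(\<Sum>k<?M. ennreal (etac_cond ps (Suc k))) = ennreal (\<Sum>k<?M. etac_pred ps (Suc k))"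
    by (subst sum_ennreal[symmetric])
       (auto simp: etac_cond_def intro!: less_imp_le[OF etac_pred_pos] sum.cong)
  also have "(\<Sum>k. ennreal (etac_cond ps (Suc (k + ?M))))
      = (\<Sum>k. ennreal (etac_pred ps 0) * ennreal (2 powr - real (elias_len (Suc (Suc k)))))"
    by (intro suminf_cong) (simp add: etac_cond_def ennreal_mult' less_imp_le[OF etac_pred_pos])
  also have "\<dots> = ennreal (etac_pred ps 0) * (\<Sum>k. ennreal (2 powr - real (elias_len (Suc (Suc k)))))"
    by (rule ennreal_suminf_cmult)
  finally have "(\<Sum>k. ennreal (etac_cond ps (Suc k)))
      = ennreal (etac_pred ps 0) * (\<Sum>k. ennreal (2 powr - real (elias_len (Suc (Suc k)))))
        + ennreal (\<Sum>k<?M. etac_pred ps (Suc k))" .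
  also have "\<dots> \<le> ennreal (etac_pred ps 0) * 1 + ennreal (\<Sum>k<?M. etac_pred ps (Suc k))"
    by (intro add_right_mono mult_left_mono elias_tail) simp
  also have "\<dots> = ennreal (etac_pred ps 0 + (\<Sum>k<?M. etac_pred ps (Suc k)))"
    by (subst ennreal_plus) (auto intro!: sum_nonneg less_imp_le[OF etac_pred_pos])
  also have "\<dots> \<le> ennreal 1"
  proof (intro ennreal_leI)
    have "(\<Sum>k<?M. etac_pred ps (Suc k)) = (\<Sum>k<?M. real (count_list ps (Suc k)) + 1/2) / (real ?i + (real ?M + 1) / 2)"
      unfolding sum_divide_distrib by (intro sum.cong) (auto simp: etac_pred_def)
    also have "(\<Sum>k<?M. real (count_list ps (Suc k)) + 1/2) = real (\<Sum>k<?M. count_list ps (Suc k)) + real ?M / 2"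
      by (simp add: sum.distrib)
    finally have succ: "(\<Sum>k<?M. etac_pred ps (Suc k))
      = (real (\<Sum>k<?M. count_list ps (Suc k)) + real ?M / 2) / (real ?i + (real ?M + 1) / 2)" .
    have zero: "etac_pred ps 0 = 1/2 / (real ?i + (real ?M + 1) / 2)"
      by (simp only: etac_pred_def le0 if_True refl of_nat_0 add_0)
    have "etac_pred ps 0 + (\<Sum>k<?M. etac_pred ps (Suc k))
      = (1/2 + (real (\<Sum>k<?M. count_list ps (Suc k)) + real ?M / 2)) / (real ?i + (real ?M + 1) / 2)"
      unfolding succ zero by (simp only: add_divide_distrib)
    moreover have "real (\<Sum>k<?M. count_list ps (Suc k)) \<le> real ?i"
      using sum_count_list_le by (simp only: of_nat_le_iff)
    moreover have "(1/2 + (s + real ?M / 2)) / (real ?i + (real ?M + 1) / 2) \<le> 1"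
      if "s \<le> real ?i" for s :: real
    proof -
      have "0 < real ?i + (real ?M + 1) / 2" by (intro add_nonneg_pos) auto
      then show ?thesis using that by (simp only: divide_le_eq_1_pos) (simp add: add_divide_distrib)
    qed
    ultimately show "etac_pred ps 0 + (\<Sum>k<?M. etac_pred ps (Suc k)) \<le> 1" by (simp only:)
  qed
  finally show ?thesis by simp
qed

lemma countable_seqs: "countable (seqs n)"
  by (rule countable_subset[OF subset_UNIV]) simp

lemma nn_integral_seqs_snoc:
  "(\<integral>\<^sup>+xs. h xs \<partial>count_space (seqs (Suc n)))
     = (\<integral>\<^sup>+xs. (\<Sum>k. h (xs @ [Suc k])) \<partial>count_space (seqs n))"
proof -
  let ?g = "\<lambda>(xs, k). xs @ [Suc k] :: nat list"
  interpret sigma_finite_measure "count_space (UNIV :: nat set)"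
    by (rule sigma_finite_measure_count_space_countable) simp
  have "bij_betw ?g (seqs n \<times> UNIV) (seqs (Suc n))"
  proof (intro bij_betw_byWitness[where f' = "\<lambda>xs. (butlast xs, last xs - 1)"])
    show "\<forall>xs\<in>seqs (Suc n). ?g (butlast xs, last xs - 1) = xs"
    proof
      fix xs assume "xs \<in> seqs (Suc n)"
      then have "xs \<noteq> []" "\<forall>x\<in>set xs. 0 < x" by (auto simp: seqs_def)
      then have "Suc (last xs - 1) = last xs" by (simp add: Suc_pred')
      then show "?g (butlast xs, last xs - 1) = xs" using \<open>xs \<noteq> []\<close> by simp
    qed
  qed (auto simp: seqs_def dest: in_set_butlastD)
  then have "(\<integral>\<^sup>+xs. h xs \<partial>count_space (seqs (Suc n))) = (\<integral>\<^sup>+z. h (?g z) \<partial>count_space (seqs n \<times> UNIV))"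
    by (rule nn_integral_bij_count_space[symmetric])
  also have "\<dots> = (\<integral>\<^sup>+z. h (?g z) \<partial>(count_space (seqs n) \<Otimes>\<^sub>M count_space UNIV))"
    by (simp add: pair_measure_countable countable_seqs)
  also have "\<dots> = (\<integral>\<^sup>+xs. \<integral>\<^sup>+k. h (xs @ [Suc k]) \<partial>count_space UNIV \<partial>count_space (seqs n))"
    by (subst nn_integral_fst[symmetric]) (auto simp: pair_measure_countable countable_seqs)
  finally show ?thesis by (simp add: nn_integral_count_space_nat)
qed

lemma etac_prefix_kraft: "(\<integral>\<^sup>+xs. ennreal (etac_prefix xs) \<partial>count_space (seqs (Suc n))) \<le> 1"
proof (induction n)
  case 0
  have "seqs 0 = {[]}" by (auto simp: seqs_def)
  then show ?case
    using elias_kraft by (simp add: nn_integral_seqs_snoc nn_integral_count_space_finite etac_prefix_def)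
next
  case (Suc n)
  have "(\<integral>\<^sup>+xs. ennreal (etac_prefix xs) \<partial>count_space (seqs (Suc (Suc n))))
      = (\<integral>\<^sup>+xs. (\<Sum>k. ennreal (etac_prefix (xs @ [Suc k]))) \<partial>count_space (seqs (Suc n)))"
    by (rule nn_integral_seqs_snoc)
  also have "\<dots> \<le> (\<integral>\<^sup>+xs. ennreal (etac_prefix xs) \<partial>count_space (seqs (Suc n)))"
  proof (intro nn_integral_mono)
    fix xs assume "xs \<in> space (count_space (seqs (Suc n)))"
    then have ne: "xs \<noteq> []" by (auto simp: seqs_def)
    have "(\<Sum>k. ennreal (etac_prefix (xs @ [Suc k])))
        = ennreal (etac_prefix xs) * (\<Sum>k. ennreal (etac_cond xs (Suc k)))"
      using ne etac_prefix_pos[of xs]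
      by (simp add: etac_prefix_snoc ennreal_mult' less_imp_le flip: ennreal_suminf_cmult)
    also have "\<dots> \<le> ennreal (etac_prefix xs) * 1"
      by (intro mult_left_mono etac_cond_kraft ne) simp
    finally show "(\<Sum>k. ennreal (etac_prefix (xs @ [Suc k]))) \<le> ennreal (etac_prefix xs)" by simp
  qed
  also have "\<dots> \<le> 1" by (rule Suc.IH)
  finally show ?case .
qed

text \<open>Since \<open>Z \<le> 1\<close>, normalising can only increase probabilities, and
  codelength bounds carry over from \<open>etac_weight\<close> to \<open>etac_prob\<close>.
  Convergence is part of the claim because an infinite sum that does not converge would be 0 by
  convention.\<close>

lemma etac_normaliser:
  assumes "1 \<le> n"
  defines "Z \<equiv> (\<Sum>\<^sub>\<infinity> ys\<in>seqs n. etac_weight ys)"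
  shows "(etac_weight has_sum Z) (seqs n)" "0 < Z" "Z \<le> 1"
proof -
  have ne: "xs \<noteq> []" if "xs \<in> seqs n" for xs using that assms by (auto simp: seqs_def)
  have nn: "0 \<le> etac_weight xs" if "xs \<in> seqs n" for xs
    using etac_weight_pos[OF ne[OF that]] by simp
  have "(\<integral>\<^sup>+xs. ennreal (etac_weight xs) \<partial>count_space (seqs n))
     \<le> (\<integral>\<^sup>+xs. ennreal (etac_prefix xs) \<partial>count_space (seqs n))"
    using ne etac_prefix_pos etac_pred_0_le_1
    by (intro nn_integral_mono ennreal_leI) (auto simp: etac_weight_eq mult_left_le less_imp_le)
  also have "\<dots> \<le> 1" using etac_prefix_kraft[of "n - 1"] assms by simp
  finally have le: "(\<integral>\<^sup>+xs. ennreal (etac_weight xs) \<partial>count_space (seqs n)) \<le> 1" .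
  then obtain z where z: "(\<integral>\<^sup>+xs. ennreal (etac_weight xs) \<partial>count_space (seqs n)) = ennreal z" "0 \<le> z"
    by (cases "\<integral>\<^sup>+xs. ennreal (etac_weight xs) \<partial>count_space (seqs n)") (auto simp: top_unique)
  have "(etac_weight has_sum z) (seqs n)" by (rule has_sum_of_nn_integral[OF nn z])
  then have Z: "Z = z" unfolding Z_def by (rule infsumI)
  show "(etac_weight has_sum Z) (seqs n)" unfolding Z by fact
  show "Z \<le> 1" using le z unfolding Z by simp
  have "replicate n 1 \<in> seqs n" by (auto simp: seqs_def)
  then have "ennreal (etac_weight (replicate n 1)) \<le> ennreal z"
    unfolding z(1)[symmetric] by (rule nn_integral_ge_point)
  then show "0 < Z"
    using etac_weight_pos[of "replicate n 1"] assms z(2) unfolding Z by (auto simp: ennreal_le_iff)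
qed

lemma etac_prob_coding:
  assumes "1 \<le> n"
  shows "is_coding_prob n (etac_prob n)"
proof -
  note Z = etac_normaliser[OF assms]
  let ?Z = "\<Sum>\<^sub>\<infinity> ys\<in>seqs n. etac_weight ys"
  have "((\<lambda>xs. 1 / ?Z * etac_weight xs) has_sum 1 / ?Z * ?Z) (seqs n)"
    by (intro has_sum_cmult_right Z)
  then have "((\<lambda>xs. 1 / ?Z * etac_weight xs) has_sum 1) (seqs n)" using Z by simp
  then have "(etac_prob n has_sum 1) (seqs n)"
    by (rule has_sum_cong[THEN iffD1, rotated]) (simp add: etac_prob_def)
  moreover have "0 \<le> etac_prob n xs" for xs
  proof (cases "xs \<in> seqs n")
    case True
    then have "xs \<noteq> []" using assms by (auto simp: seqs_def)
    then show ?thesis using etac_weight_pos[of xs] Z(2) True by (simp add: etac_prob_def)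
  qed (simp add: etac_prob_def)
  ultimately show ?thesis by (simp add: is_coding_prob_def)
qed

section \<open>Pathwise and expected cost of the ETAC code\<close>

text \<open>The multinomial coefficient built symbol by symbol: appending \<open>x\<close>
  multiplies it by the new length over the new count of \<open>x\<close>.\<close>

lemma card_permutations_of_multiset_prod:
  "real (card (permutations_of_multiset (mset xs)))
     = (\<Prod>i<length xs. real (Suc i) / (real (count_list (take i xs) (xs ! i)) + 1))"
proof (induction xs rule: rev_induct)
  case (snoc x xs)
  let ?A = "mset xs"
  have "(\<Prod>i<length xs. real (Suc i) / (real (count_list (take i (xs @ [x])) ((xs @ [x]) ! i)) + 1))
      = (\<Prod>i<length xs. real (Suc i) / (real (count_list (take i xs) (xs ! i)) + 1))"
    by (intro prod.cong) (auto simp: nth_append)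
  then have prod: "(\<Prod>i<length (xs @ [x]). real (Suc i) / (real (count_list (take i (xs @ [x])) ((xs @ [x]) ! i)) + 1))
      = real (card (permutations_of_multiset ?A)) * (real (Suc (length xs)) / (real (count_list xs x) + 1))"
    using snoc by (simp add: nth_append)
  have "real (card (permutations_of_multiset (?A + {#x#})) * (count ?A x + 1))
      = real ((size ?A + 1) * card (permutations_of_multiset ?A))"
    by (simp only: card_permutations_of_multiset_insert_aux)
  then show ?case unfolding prod by (simp add: count_mset field_simps)
qed simp

lemma iid_prob_mset: "mset xs = mset ys \<Longrightarrow> iid_prob p xs = iid_prob p ys"
  unfolding iid_prob_def by (metis mset_map prod_mset_prod_list)

text \<open>All rearrangements of \<open>xs\<close> are equally likely and together form an event.
  The bound holds for every source and every alphabet size.\<close>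

lemma multinomial_prob_le_1:
  assumes p: "is_source p" and xs: "xs \<in> seqs n"
  shows "iid_prob p xs * (\<Prod>i<n. real (Suc i) / (real (count_list (take i xs) (xs ! i)) + 1)) \<le> 1"
proof -
  let ?S = "permutations_of_multiset (mset xs)"
  have "ys \<in> seqs n" if "ys \<in> ?S" for ys
    using that xs mset_eq_setD[of ys xs] mset_eq_length[of ys xs]
    by (auto simp: seqs_def permutations_of_multiset_def)
  then have "measure (iid_pmf n p) ?S = (\<Sum>ys\<in>?S. iid_prob p ys)"
    by (simp add: measure_measure_pmf_finite pmf_iid_pmf[OF p] cong: sum.cong)
  also have "\<dots> = (\<Sum>ys\<in>?S. iid_prob p xs)"
    by (intro sum.cong iid_prob_mset) (auto simp: permutations_of_multiset_def)
  also have "\<dots> = iid_prob p xs * (\<Prod>i<length xs. real (Suc i) / (real (count_list (take i xs) (xs ! i)) + 1))"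
    unfolding card_permutations_of_multiset_prod[symmetric] by simp
  finally show ?thesis
    using xs measure_pmf.prob_le_1[of "iid_pmf n p" ?S] by (simp add: seqs_def)
qed

text \<open>Group the positions by symbol: the successive occurrences of \<open>j\<close> contribute
  1, 1/2, 1/3, and so on up to its final count.\<close>

lemma sum_inverse_occurrences:
  fixes xs :: "nat list"
  shows
  "(\<Sum>i<length xs. if 1 \<le> xs ! i \<and> xs ! i \<le> V then 1 / (real (count_list (take i xs) (xs ! i)) + 1) else 0)
     = (\<Sum>j=1..V. harm (count_list xs j))"
proof (induction xs rule: rev_induct)
  case (snoc x xs)
  let ?g = "\<lambda>zs i. if 1 \<le> zs ! i \<and> zs ! i \<le> V then 1 / (real (count_list (take i zs) (zs ! i)) + 1) else 0"
  have "(\<Sum>i<length xs. ?g (xs @ [x]) i) = (\<Sum>i<length xs. ?g xs i)"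
    by (intro sum.cong) (auto simp: nth_append)
  then have "(\<Sum>i<length (xs @ [x]). ?g (xs @ [x]) i)
    = (\<Sum>j=1..V. harm (count_list xs j)) + (if 1 \<le> x \<and> x \<le> V then 1 / (real (count_list xs x) + 1) else 0)"
    using snoc by (simp add: nth_append)
  also have "(if 1 \<le> x \<and> x \<le> V then 1 / (real (count_list xs x) + 1) else 0)
     = (\<Sum>j=1..V. if j = x then 1 / (real (count_list xs x) + 1) else 0)"
    by (subst sum.delta) auto
  also have "(\<Sum>j=1..V. harm (count_list xs j)) + \<dots> = (\<Sum>j=1..V. harm (count_list (xs @ [x]) j))"
    unfolding sum.distrib[symmetric]
    by (intro sum.cong) (auto simp: harm_Suc inverse_eq_divide add.commute)
  finally show ?case .
qed (simp add: harm_def)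

lemma sum_inverse_occurrences_le:
  fixes xs :: "nat list"
  shows
  "(\<Sum>i<length xs. if 1 \<le> xs ! i \<and> xs ! i \<le> V then 1 / (real (count_list (take i xs) (xs ! i)) + 1) else 0)
     \<le> real V * harm (length xs)"
proof -
  have "(\<Sum>j=1..V. harm (count_list xs j)) \<le> (\<Sum>j=1..V. harm (length xs) :: real)"
    by (intro sum_mono harm_mono count_le_length)
  then show ?thesis unfolding sum_inverse_occurrences by simp
qed

section \<open>Expected number of censored symbols\<close>

lemma swap_nth_take:
  assumes "i < length xs" "j \<le> i"
  shows "add_mset (xs ! j) (mset (take i (swap_nth i j xs))) = mset (take (Suc i) xs)"
proof -
  let ?ys = "swap_nth i j xs"
  have len: "length ?ys = length xs" "?ys ! i = xs ! j" using assms by (auto simp: swap_nth_simps)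
  have "take (Suc i) ?ys = swap_nth i j (take (Suc i) xs)"
    using assms by (simp add: swap_nth_def take_update_swap)
  then have "mset (take (Suc i) ?ys) = mset (take (Suc i) xs)"
    using assms by (simp add: swap_nth_simps)
  moreover have "take (Suc i) ?ys = take i ?ys @ [?ys ! i]"
    using assms len by (simp add: take_Suc_conv_app_nth)
  ultimately show ?thesis using len by simp
qed

text \<open>Among \<open>i + 1\<close> symbols, few would be censored if they came last: take such a symbol with the
  smallest threshold \<open>k\<close>; all of them exceed \<open>k\<close>, and by definition of \<open>k\<close> at most \<open>k + 1\<close> symbols do.\<close>
lemma card_censored_positions:
  assumes "1 \<le> i" "i < length xs"
  shows "card {j. j \<le> i \<and> etac_M (take i (swap_nth i j xs)) < xs ! j \<and> xs ! j \<le> V} \<le> V"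
proof -
  let ?M = "\<lambda>j. etac_M (take i (swap_nth i j xs))"
  let ?J = "{j. j \<le> i \<and> ?M j < xs ! j \<and> xs ! j \<le> V}"
  show ?thesis
  proof (cases "?J = {}")
    case False
    then obtain j1 where "j1 \<in> ?J" by blast
    then obtain j0 where j0: "j0 \<in> ?J" and min: "\<And>j. j \<in> ?J \<Longrightarrow> ?M j0 \<le> ?M j"
      using ex_has_least_nat[of "\<lambda>j. j \<in> ?J" j1 ?M] by blast
    let ?k = "?M j0" and ?ps = "take i (swap_nth i j0 xs)"
    have "?ps \<noteq> []" using assms j0 by (auto simp: swap_nth_def)
    then have ca: "count_above ?ps ?k \<le> ?k" by (rule etac_M_bounds)
    have "mset (take (Suc i) xs) = mset (?ps @ [xs ! j0])"
      using swap_nth_take[of i xs j0] assms j0 by simp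
    then have "count_above (take (Suc i) xs) ?k = count_above (?ps @ [xs ! j0]) ?k"
      by (rule count_above_mset)
    also have "\<dots> \<le> ?k + 1" using ca by (simp add: count_above_def)
    finally have le: "count_above (take (Suc i) xs) ?k \<le> ?k + 1" .
    have "?J \<subseteq> {j. j < length (take (Suc i) xs) \<and> ?k < take (Suc i) xs ! j}"
    proof
      fix j assume j: "j \<in> ?J"
      then have "?k < xs ! j" using min[OF j] by (simp add: le_less_trans)
      then show "j \<in> {j. j < length (take (Suc i) xs) \<and> ?k < take (Suc i) xs ! j}"
        using j assms by simp
    qed
    then have "card ?J \<le> card {j. j < length (take (Suc i) xs) \<and> ?k < take (Suc i) xs ! j}"
      by (intro card_mono) auto
    also have "\<dots> = count_above (take (Suc i) xs) ?k"
      unfolding count_above_def by (rule length_filter_conv_card[symmetric])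
    \<comment> \<open>The symbol at \<open>j0\<close> is itself above \<open>?k\<close> and at most
      \<open>V\<close>, hence \<open>?k + 1 \<le> V\<close>.\<close>
    finally show ?thesis using le j0 by simp
  next
    case True
    show ?thesis unfolding True by simp
  qed
qed

text \<open>By exchangeability the \<open>i + 1\<close> swapped events have equal probability, and
  pathwise their indicators add up to a count of at most \<open>V\<close>. The resulting bound is
  the same for every source.\<close>

lemma prob_censored_le:
  assumes i: "1 \<le> i" "i < n"
  shows "(\<integral>\<^sup>+xs. (if etac_M (take i xs) < xs ! i \<and> xs ! i \<le> V then 1 else 0) \<partial>iid_pmf n p)
    \<le> ennreal (real V / real (Suc i))"
proof -
  define a :: "nat list \<Rightarrow> ennreal" where
    "a xs = (if etac_M (take i xs) < xs ! i \<and> xs ! i \<le> V then 1 else 0)" for xs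
  let ?I = "\<integral>\<^sup>+xs. a xs \<partial>iid_pmf n p"
  have "of_nat (Suc i) * ?I = (\<Sum>j\<le>i. ?I)" by simp
  also have "\<dots> = (\<Sum>j\<le>i. \<integral>\<^sup>+xs. a (swap_nth i j xs) \<partial>iid_pmf n p)"
    using i by (intro sum.cong nn_integral_iid_swap[symmetric]) auto
  also have "\<dots> = (\<integral>\<^sup>+xs. (\<Sum>j\<le>i. a (swap_nth i j xs)) \<partial>iid_pmf n p)"
    by (rule nn_integral_sum[symmetric]) simp
  also have "\<dots> \<le> (\<integral>\<^sup>+xs. of_nat V \<partial>iid_pmf n p)"
  proof (rule nn_integral_mono_AE, unfold AE_measure_pmf_iff, rule ballI)
    fix xs assume "xs \<in> set_pmf (iid_pmf n p)"
    then have len: "length xs = n" by (simp add: iid_pmf_def set_replicate_pmf)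
    let ?J = "{j. j \<le> i \<and> etac_M (take i (swap_nth i j xs)) < xs ! j \<and> xs ! j \<le> V}"
    have "(\<Sum>j\<le>i. a (swap_nth i j xs)) = (\<Sum>j\<le>i. if j \<in> ?J then 1 else 0)"
      using i len by (intro sum.cong) (auto simp: a_def swap_nth_simps)
    also have "\<dots> = (\<Sum>j\<in>?J. 1)"
      by (intro sum.mono_neutral_cong_right) auto
    also have "\<dots> = of_nat (card ?J)" by simp
    also have "\<dots> \<le> of_nat V"
      using card_censored_positions[of i xs V] i len by (intro of_nat_mono) simp
    finally show "(\<Sum>j\<le>i. a (swap_nth i j xs)) \<le> of_nat V" .
  qed
  also have "\<dots> = of_nat V" by simp
  finally have le: "of_nat (Suc i) * ?I \<le> of_nat V" .
  have "?I \<le> (\<integral>\<^sup>+xs. 1 \<partial>iid_pmf n p)" by (intro nn_integral_mono) (simp add: a_def)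
  then have "?I \<le> 1" by simp
  then obtain r where r: "?I = ennreal r" "0 \<le> r" by (cases ?I) (auto simp: top_unique)
  have "ennreal (real (Suc i) * r) \<le> ennreal (real V)"
    using le r unfolding r(1) by (simp add: ennreal_mult ennreal_of_nat_eq_real_of_nat del: of_nat_Suc)
  then have "real (Suc i) * r \<le> real V" by (simp add: ennreal_le_iff)
  then have "r \<le> real V / real (Suc i)" by (simp add: field_simps)
  then show ?thesis using r unfolding a_def[symmetric] by (simp add: ennreal_leI)
qed

section \<open>Codelength against the multinomial benchmark\<close>

lemma log2_add_1_le:
  assumes "0 \<le> (x::real)"
  shows "log 2 (1 + x) \<le> 2 * x"
proof -
  have "ln (1 + x) \<le> x" using assms by (rule ln_add_one_self_le_self)
  also have "\<dots> \<le> 2 * x * ln 2" using assms ln2_ge_two_thirds mult_left_mono[of "1/2" "ln 2" "2 * x"] by simp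
  finally show ?thesis by (simp add: log_def divide_le_eq)
qed

text \<open>The benchmark is \<open>(N + 1) / (i + 1)\<close>. Replacing its denominator by that of
  the code costs \<open>M / (i + 1)\<close>, and its numerator by \<open>N + 1/2\<close> at most
  \<open>2 / (N + 1)\<close>. A censored symbol forfeits its count and pays
  \<open>1 + log 2 (N + 1)\<close> plus the Elias codeword.\<close>

lemma etac_step_cost:
  assumes ps: "ps \<noteq> []" and y: "1 \<le> y" and n: "Suc (length ps) \<le> n"
  defines "i \<equiv> length ps" and "M \<equiv> etac_M ps" and "N \<equiv> count_list ps y"
  shows "- log 2 (etac_cond ps y) - log 2 (real (Suc i) / (real N + 1))
    \<le> real M / real (Suc i) + (if y \<le> V then 2 * (1 / (real N + 1)) else 0)
      + (if M < y \<and> y \<le> V then 1 + log 2 (real V) + real (elias_len V) else 0)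
      + (if V < y then 3 + log 2 (real n) + real (elias_len y) else 0)"
proof -
  define D where "D = real i + (real M + 1) / 2"
  have M: "1 \<le> M" "M \<le> i" "count_above ps M \<le> M" using etac_M_bounds[OF ps] by (auto simp: M_def i_def)
  have D: "0 < D" unfolding D_def by (intro add_nonneg_pos) auto
  have ratio: "log 2 (D / real (Suc i)) \<le> real M / real (Suc i)"
  proof -
    have "D / real (Suc i) \<le> 1 + real M / 2 / real (Suc i)"
      by (simp add: D_def field_simps)
    then have "log 2 (D / real (Suc i)) \<le> log 2 (1 + real M / 2 / real (Suc i))"
      using D by (intro log_mono) auto
    also have "\<dots> \<le> 2 * (real M / 2 / real (Suc i))" by (intro log2_add_1_le) simp
    also have "2 * (real M / 2 / real (Suc i)) = real M / real (Suc i)" by (simp del: of_nat_Suc)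
    finally show ?thesis .
  qed
  have logr: "log 2 (real (Suc i) / (real N + 1)) = log 2 (real (Suc i)) - log 2 (real N + 1)"
    "log 2 (D / real (Suc i)) = log 2 D - log 2 (real (Suc i))"
    using D by (simp_all add: log_divide)
  show ?thesis
  proof (cases "y \<le> M")
    case True
    have "etac_cond ps y = (real N + 1/2) / D"
      using True y by (simp add: etac_cond_def etac_pred_def M_def D_def N_def i_def)
    then have "log 2 (etac_cond ps y) = log 2 (real N + 1/2) - log 2 D"
      using D by (simp add: log_divide)
    then have eq: "- log 2 (etac_cond ps y) - log 2 (real (Suc i) / (real N + 1))
        = log 2 (D / real (Suc i)) + (log 2 (real N + 1) - log 2 (real N + 1/2))"
      unfolding logr by simp
    have "log 2 (real N + 1) - log 2 (real N + 1/2) = log 2 ((real N + 1) / (real N + 1/2))"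
      by (simp add: log_divide)
    also have "(real N + 1) / (real N + 1/2) = 1 + 1 / (2 * real N + 1)"
      by (simp add: field_simps)
    also have "log 2 (1 + 1 / (2 * real N + 1)) \<le> 2 * (1 / (2 * real N + 1))"
      by (intro log2_add_1_le) simp
    also have "\<dots> \<le> 2 * (1 / (real N + 1))" by (intro mult_left_mono divide_left_mono) auto
    finally have kt: "log 2 (real N + 1) - log 2 (real N + 1/2) \<le> 2 * (1 / (real N + 1))" .
    \<comment> \<open>For an uncensored symbol above \<open>V\<close> this cost is absorbed by the
      constant 3 of the last summand.\<close>
    have two: "2 * (1 / (real N + 1)) \<le> 2" by (simp add: divide_le_eq)
    have "0 \<le> log 2 (real n)" using n by simp
    then show ?thesis unfolding eq using ratio kt two True by auto
  next
    case False
    then have yM: "M < y" by simp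
    have "etac_cond ps y = 1 / (2 * D) * 2 powr (- real (elias_len (y - M + 1)))"
      using yM by (simp add: etac_cond_def etac_pred_def M_def D_def i_def divide_simps)
    then have "log 2 (etac_cond ps y) = - (1 + log 2 D) - real (elias_len (y - M + 1))"
      using D by (simp add: log_mult log_divide)
    then have eq: "- log 2 (etac_cond ps y) - log 2 (real (Suc i) / (real N + 1))
        = log 2 (D / real (Suc i)) + (1 + log 2 (real N + 1) + real (elias_len (y - M + 1)))"
      unfolding logr by simp
    \<comment> \<open>Every earlier occurrence of a censored symbol also exceeds \<open>M\<close>,
      and at most \<open>M\<close> symbols do. Hence \<open>N + 1 \<le> M + 1 \<le> y\<close>, which
      keeps the lost count logarithmic in \<open>V\<close> when \<open>y \<le> V\<close>.\<close>
    have NM: "N \<le> M" using count_list_le_count_above[OF yM, of ps] M by (simp add: N_def)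
    have nn: "0 \<le> 2 * (1 / (real N + 1))" by simp
    show ?thesis
    proof (cases "y \<le> V")
      case True
      have c: "y \<le> V" "M < y \<and> y \<le> V" "\<not> V < y" using True yM by auto
      have "elias_len (y - M + 1) \<le> elias_len V" using M yM True by (intro elias_len_mono) auto
      then have "real (elias_len (y - M + 1)) \<le> real (elias_len V)" by simp
      moreover have "log 2 (real N + 1) \<le> log 2 (real V)" using NM yM True by (intro log_mono) auto
      ultimately show ?thesis
        unfolding eq if_P[OF c(1)] if_P[OF c(2)] if_not_P[OF c(3)] using ratio nn by linarith
    next
      case False
      then have c: "\<not> y \<le> V" "\<not> (M < y \<and> y \<le> V)" "V < y" by auto
      have "elias_len (y - M + 1) \<le> elias_len y" using M yM by (intro elias_len_mono) auto
      then have "real (elias_len (y - M + 1)) \<le> real (elias_len y)" by simp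
      moreover have "log 2 (real N + 1) \<le> log 2 (real n)"
        using NM M n by (intro log_mono) (auto simp: i_def)
      ultimately show ?thesis
        unfolding eq if_not_P[OF c(1)] if_not_P[OF c(2)] if_P[OF c(3)] using ratio by linarith
    qed
  qed
qed

lemma count_above_conv_sum: "real (count_above xs V) = (\<Sum>i<length xs. if V < xs ! i then 1 else 0)"
proof (induction xs rule: rev_induct)
  case (snoc x xs)
  have "(\<Sum>i<length xs. if V < (xs @ [x]) ! i then 1 else (0::real)) = (\<Sum>i<length xs. if V < xs ! i then 1 else 0)"
    by (intro sum.cong) (auto simp: nth_append)
  then show ?case using snoc by (simp add: count_above_append) (simp add: count_above_def)
qed (simp add: count_above_def)

lemma count_above_take_le: "count_above (take i xs) V \<le> count_above xs V"
  using count_above_append[of "take i xs" "drop i xs" V] by simp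

text \<open>Summed step costs. Each threshold is at most \<open>V + 1\<close> plus the number of
  symbols above \<open>V\<close>; the product of that number with \<open>harm n\<close> is charged
  to the large symbols, hence the \<open>harm n\<close> in their summand. In
  \<open>3 * real V + 1\<close> the part \<open>V + 1\<close> stems from the thresholds and
  \<open>2 * V\<close> from the add-1/2 corrections.\<close>

lemma etac_log_ratio_le:
  fixes n V :: nat
  assumes p: "is_source p" and n: "1 \<le> n" and V: "1 \<le> V" and xs: "xs \<in> seqs n" and pos: "0 < iid_prob p xs"
  shows "log 2 (iid_prob p xs / etac_weight xs)
    \<le> log 2 (4 * real n) + (3 * real V + 1) * harm n + real (elias_len (xs ! 0))
      + (1 + log 2 (real V) + real (elias_len V))
        * (\<Sum>i\<in>{1..<n}. if etac_M (take i xs) < xs ! i \<and> xs ! i \<le> V then 1 else 0)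
      + (\<Sum>i<n. if V < xs ! i then 3 + log 2 (real n) + harm n + real (elias_len (xs ! i)) else 0)"
proof -
  have len: "length xs = n" and ge1: "\<And>i. i < n \<Longrightarrow> 1 \<le> xs ! i"
    using xs by (auto simp: seqs_def Suc_le_eq)
  have ne: "xs \<noteq> []" using len n by auto
  define N where "N i = real (count_list (take i xs) (xs ! i)) + 1" for i
  define r where "r i = real (Suc i) / N i" for i
  define w where "w i = etac_cond (take i xs) (xs ! i)" for i
  define M where "M i = etac_M (take i xs)" for i
  let ?c = "1 + log 2 (real V) + real (elias_len V)"
  let ?H = "harm n :: real"
  let ?S = "real (count_above xs V)"
  have N: "1 \<le> N i" for i by (simp add: N_def)
  have r: "0 < r i" for i using N[of i] by (simp add: r_def)
  have w: "0 < w i" for i by (simp add: w_def etac_cond_pos)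
  have pred: "0 < etac_pred xs 0" by (rule etac_pred_pos) simp
  have W: "0 < etac_weight xs" by (rule etac_weight_pos[OF ne])
  have "log 2 (iid_prob p xs * (\<Prod>i<n. r i)) \<le> 0"
    using multinomial_prob_le_1[OF p xs] pos r
    by (subst log_le_zero_cancel_iff) (auto simp: r_def N_def intro!: mult_pos_pos prod_pos)
  moreover have "log 2 (iid_prob p xs * (\<Prod>i<n. r i)) = log 2 (iid_prob p xs) + (\<Sum>i<n. log 2 (r i))"
  proof -
    have "log 2 (\<Prod>i<n. r i) = (\<Sum>i<n. log 2 (r i))"
      using r by (intro log_prod) auto
    moreover have "0 < (\<Prod>i<n. r i)" using r by (intro prod_pos) auto
    then have "(\<Prod>i<n. r i) \<noteq> 0" by (rule less_imp_neq[symmetric])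
    ultimately show ?thesis using pos by (simp add: log_mult del: prod_zero_iff)
  qed
  \<comment> \<open>The factor \<open>r 0\<close> is 1, so the benchmark effectively starts, like
    the arithmetic code, with the second symbol.\<close>
  moreover have "(\<Sum>i<n. log 2 (r i)) = (\<Sum>i\<in>{1..<n}. log 2 (r i))"
  proof -
    have "{..<n} = insert 0 {1..<n}" using n by auto
    then show ?thesis by (simp add: r_def N_def)
  qed
  ultimately have multi: "log 2 (iid_prob p xs) \<le> (\<Sum>i\<in>{1..<n}. - log 2 (r i))"
    by (simp add: sum_negf)
  have "log 2 (etac_weight xs) = log 2 (etac_prefix xs) + log 2 (etac_pred xs 0)"
    using etac_prefix_pos[of xs] pred by (simp add: etac_weight_eq[OF ne] log_mult)
  also have "log 2 (etac_prefix xs) = - real (elias_len (xs ! 0)) + (\<Sum>i\<in>{1..<n}. log 2 (w i))"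
  proof -
    have "etac_prefix xs = 2 powr (- real (elias_len (xs ! 0))) * (\<Prod>i\<in>{1..<n}. w i)"
      unfolding etac_prefix_def len w_def hd_conv_nth[OF ne] ..
    moreover have "log 2 (\<Prod>i\<in>{1..<n}. w i) = (\<Sum>i\<in>{1..<n}. log 2 (w i))"
      using w by (intro log_prod) auto
    moreover have "0 < (\<Prod>i\<in>{1..<n}. w i)" using w by (intro prod_pos) auto
    then have "(\<Prod>i\<in>{1..<n}. w i) \<noteq> 0" by (rule less_imp_neq[symmetric])
    ultimately show ?thesis by (simp add: log_mult del: prod_zero_iff)
  qed
  finally have logW: "log 2 (etac_weight xs)
      = - real (elias_len (xs ! 0)) + (\<Sum>i\<in>{1..<n}. log 2 (w i)) + log 2 (etac_pred xs 0)" .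
  \<comment> \<open>The terminating 0: its inverse probability is \<open>2 * n + M + 1\<close> with
    \<open>M \<le> n\<close>.\<close>
  have final: "- log 2 (etac_pred xs 0) \<le> log 2 (4 * real n)"
  proof -
    have "1 / etac_pred xs 0 = 2 * real n + (real (etac_M xs) + 1)"
      by (simp add: etac_pred_def len field_simps)
    moreover have "real (etac_M xs) \<le> real n" using etac_M_bounds[OF ne] len by simp
    ultimately have "1 / etac_pred xs 0 \<le> 4 * real n" using n by simp
    then have "log 2 (1 / etac_pred xs 0) \<le> log 2 (4 * real n)" using pred by (intro log_mono) auto
    then show ?thesis using pred by (simp add: log_divide)
  qed
  have "(\<Sum>i\<in>{1..<n}. - log 2 (w i) - log 2 (r i))
     \<le> (\<Sum>i\<in>{1..<n}. real (M i) / real (Suc i) + (if xs ! i \<le> V then 2 * (1 / N i) else 0)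
      + (if M i < xs ! i \<and> xs ! i \<le> V then ?c else 0)
      + (if V < xs ! i then 3 + log 2 (real n) + real (elias_len (xs ! i)) else 0))"
  proof (intro sum_mono)
    fix i assume i: "i \<in> {1..<n}"
    have ps: "take i xs \<noteq> []" "length (take i xs) = i" using i len by auto
    show "- log 2 (w i) - log 2 (r i) \<le> real (M i) / real (Suc i) + (if xs ! i \<le> V then 2 * (1 / N i) else 0)
      + (if M i < xs ! i \<and> xs ! i \<le> V then ?c else 0)
      + (if V < xs ! i then 3 + log 2 (real n) + real (elias_len (xs ! i)) else 0)"
      using etac_step_cost[OF ps(1) ge1[of i], of n V] i ps(2)
      by (simp only: w_def r_def N_def M_def atLeastLessThan_iff Suc_leI)
  qed
  also have "\<dots> = (\<Sum>i\<in>{1..<n}. real (M i) / real (Suc i)) + (\<Sum>i\<in>{1..<n}. if xs ! i \<le> V then 2 * (1 / N i) else 0)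
      + (\<Sum>i\<in>{1..<n}. if M i < xs ! i \<and> xs ! i \<le> V then ?c else 0)
      + (\<Sum>i\<in>{1..<n}. if V < xs ! i then 3 + log 2 (real n) + real (elias_len (xs ! i)) else 0)"
    by (simp only: sum.distrib)
  finally have steps: "(\<Sum>i\<in>{1..<n}. - log 2 (w i) - log 2 (r i)) \<le> \<dots>" .
  have s1: "(\<Sum>i\<in>{1..<n}. real (M i) / real (Suc i)) \<le> (real V + 1 + ?S) * ?H"
  proof -
    have "(\<Sum>i\<in>{1..<n}. real (M i) / real (Suc i)) \<le> (\<Sum>i\<in>{1..<n}. (real V + 1 + ?S) * inverse (real (Suc i)))"
    proof (intro sum_mono)
      fix i
      have "M i \<le> V + count_above xs V + 1"
        using etac_M_le[of "take i xs" V] count_above_take_le[of i xs V] by (simp add: M_def)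
      then have "real (M i) \<le> real V + 1 + ?S" by linarith
      then show "real (M i) / real (Suc i) \<le> (real V + 1 + ?S) * inverse (real (Suc i))"
        unfolding divide_inverse by (intro mult_right_mono) auto
    qed
    also have "\<dots> \<le> (\<Sum>i<n. (real V + 1 + ?S) * inverse (real (Suc i)))"
      by (intro sum_mono2) auto
    finally show ?thesis by (simp only: harm_altdef sum_distrib_left)
  qed
  have s2: "(\<Sum>i\<in>{1..<n}. if xs ! i \<le> V then 2 * (1 / N i) else 0) \<le> 2 * (real V * ?H)"
  proof -
    have "(\<Sum>i\<in>{1..<n}. if xs ! i \<le> V then 2 * (1 / N i) else 0)
       \<le> (\<Sum>i<n. if xs ! i \<le> V then 2 * (1 / N i) else 0)"
      using N by (intro sum_mono2) (auto intro: order_trans[OF zero_le_one])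
    also have "\<dots> = 2 * (\<Sum>i<n. if 1 \<le> xs ! i \<and> xs ! i \<le> V then 1 / N i else 0)"
      unfolding sum_distrib_left using ge1 by (intro sum.cong) auto
    also have "\<dots> \<le> 2 * (real V * ?H)"
      using sum_inverse_occurrences_le[of xs V] unfolding len N_def by simp
    finally show ?thesis .
  qed
  have s3: "(\<Sum>i\<in>{1..<n}. if M i < xs ! i \<and> xs ! i \<le> V then ?c else 0)
      = ?c * (\<Sum>i\<in>{1..<n}. if M i < xs ! i \<and> xs ! i \<le> V then 1 else 0)"
    unfolding sum_distrib_left by (intro sum.cong) auto
  have s4: "(\<Sum>i\<in>{1..<n}. if V < xs ! i then 3 + log 2 (real n) + real (elias_len (xs ! i)) else 0) + ?S * ?H
      \<le> (\<Sum>i<n. if V < xs ! i then 3 + log 2 (real n) + ?H + real (elias_len (xs ! i)) else 0)"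
  proof -
    have ln: "0 \<le> log 2 (real n)" using n by simp
    have "(\<Sum>i\<in>{1..<n}. if V < xs ! i then 3 + log 2 (real n) + real (elias_len (xs ! i)) else 0)
      \<le> (\<Sum>i<n. if V < xs ! i then 3 + log 2 (real n) + real (elias_len (xs ! i)) else 0)"
      using ln by (intro sum_mono2) auto
    moreover have "?S * ?H = (\<Sum>i<n. if V < xs ! i then ?H else 0)"
      unfolding count_above_conv_sum len sum_distrib_right by (intro sum.cong) auto
    moreover have "(\<Sum>i<n. if V < xs ! i then 3 + log 2 (real n) + real (elias_len (xs ! i)) else 0)
        + (\<Sum>i<n. if V < xs ! i then ?H else 0)
      = (\<Sum>i<n. if V < xs ! i then 3 + log 2 (real n) + ?H + real (elias_len (xs ! i)) else 0)"
      unfolding sum.distrib[symmetric] by (intro sum.cong) auto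
    ultimately show ?thesis by linarith
  qed
  have "log 2 (iid_prob p xs / etac_weight xs) = log 2 (iid_prob p xs) - log 2 (etac_weight xs)"
    using pos W by (simp add: log_divide)
  also have "\<dots> \<le> real (elias_len (xs ! 0)) + (\<Sum>i\<in>{1..<n}. - log 2 (w i) - log 2 (r i)) + log 2 (4 * real n)"
    using multi final unfolding logW sum_subtractf sum_negf by linarith
  also have "\<dots> \<le> log 2 (4 * real n) + (3 * real V + 1) * ?H + real (elias_len (xs ! 0))
      + ?c * (\<Sum>i\<in>{1..<n}. if M i < xs ! i \<and> xs ! i \<le> V then 1 else 0)
      + (\<Sum>i<n. if V < xs ! i then 3 + log 2 (real n) + ?H + real (elias_len (xs ! i)) else 0)"
  proof -
    have "(real V + 1 + ?S) * ?H + 2 * (real V * ?H) = (3 * real V + 1) * ?H + ?S * ?H"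
      by (simp add: algebra_simps)
    then show ?thesis using steps s1 s2 s3 s4 by linarith
  qed
  finally show ?thesis unfolding M_def .
qed

text \<open>Expectation of the pathwise bound. The source enters through \<open>E0\<close>, for the
  first codeword, and \<open>T\<close>, for the cost of one symbol beyond \<open>V\<close>; both are
  later bounded uniformly over the class.\<close>

lemma KL_etac_le:
  fixes n V :: nat
  assumes p: "is_source p" and n: "1 \<le> n" and V: "1 \<le> V" and E0: "0 \<le> E0" and T: "0 \<le> T"
    and elias: "(\<integral>\<^sup>+x. ennreal (real (elias_len x)) \<partial>embed_pmf p) \<le> ennreal E0"
    and tail: "(\<integral>\<^sup>+x. (if V < x then ennreal (3 + log 2 (real n) + harm n + real (elias_len x)) else 0) \<partial>embed_pmf p)
      \<le> ennreal T"
  shows "KL_div (seqs n) (iid_prob p) (etac_prob n)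
    \<le> ereal (log 2 (4 * real n) + (3 * real V + 1) * harm n + E0
       + (1 + log 2 (real V) + real (elias_len V)) * (real V * harm n) + real n * T)"
proof -
  let ?H = "harm n :: real"
  let ?K = "log 2 (4 * real n) + (3 * real V + 1) * ?H"
  let ?c = "1 + log 2 (real V) + real (elias_len V)"
  let ?h = "\<lambda>x. if V < x then 3 + log 2 (real n) + ?H + real (elias_len x) else 0"
  let ?a = "\<lambda>i xs. if etac_M (take i xs) < xs ! i \<and> xs ! i \<le> V then 1 else (0::real)"
  define B where "B xs = ?K + real (elias_len (xs ! 0)) + ?c * (\<Sum>i\<in>{1..<n}. ?a i xs) + (\<Sum>i<n. ?h (xs ! i))" for xs
  have K: "0 \<le> ?K" using n by (intro add_nonneg_nonneg mult_nonneg_nonneg) (auto simp: harm_nonneg)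
  have c: "0 \<le> ?c" using V by simp
  have h: "0 \<le> ?h x" for x using n by (simp add: harm_nonneg add_nonneg_nonneg)
  have ennreal_plus4: "ennreal (a + b + c + d) = ennreal a + ennreal b + ennreal c + ennreal d"
    if "0 \<le> a" "0 \<le> b" "0 \<le> c" "0 \<le> d" for a b c d
    using that by simp
  note Z = etac_normaliser[OF n]
  let ?Z = "\<Sum>\<^sub>\<infinity> ys\<in>seqs n. etac_weight ys"
  show ?thesis
  proof (rule KL_div_le[where B = B])
    fix xs assume xs: "xs \<in> seqs n"
    then have ne: "xs \<noteq> []" using n by (auto simp: seqs_def)
    have Q: "etac_prob n xs = etac_weight xs / ?Z" using xs by (simp add: etac_prob_def)
    have W: "0 < etac_weight xs" by (rule etac_weight_pos[OF ne])
    show "kl_summand (iid_prob p xs) (etac_prob n xs) \<le> ereal (iid_prob p xs * B xs)"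
    proof (cases "iid_prob p xs = 0")
      case False
      then have pos: "0 < iid_prob p xs" using iid_prob_nonneg[OF p, of xs] by simp
      have "iid_prob p xs / etac_prob n xs = iid_prob p xs / etac_weight xs * ?Z"
        using W Z by (simp add: Q)
      also have "\<dots> \<le> iid_prob p xs / etac_weight xs * 1"
        using W Z pos by (intro mult_left_mono) auto
      finally have "log 2 (iid_prob p xs / etac_prob n xs) \<le> log 2 (iid_prob p xs / etac_weight xs)"
        using pos W Z by (intro log_mono) (auto simp: Q)
      also have "\<dots> \<le> B xs" unfolding B_def by (rule etac_log_ratio_le[OF p n V xs pos])
      finally have "iid_prob p xs * log 2 (iid_prob p xs / etac_prob n xs) \<le> iid_prob p xs * B xs"
        using pos by (intro mult_left_mono) auto
      then show ?thesis using pos W Z by (simp add: kl_summand_def Q)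
    qed (simp add: kl_summand_def)
  next
    show "0 \<le> iid_prob p xs" for xs by (rule iid_prob_nonneg[OF p])
  next
    show "0 \<le> ?K + E0 + ?c * (real V * ?H) + real n * T"
    proof -
      have "0 \<le> ?c * (real V * ?H)" by (rule mult_nonneg_nonneg[OF c]) (simp add: harm_nonneg)
      moreover have "0 \<le> real n * T" using T by simp
      ultimately show ?thesis using K E0 by linarith
    qed
  next
    have "(\<integral>\<^sup>+xs. ennreal (iid_prob p xs) * ennreal (B xs) \<partial>count_space (seqs n)) = (\<integral>\<^sup>+xs. ennreal (B xs) \<partial>iid_pmf n p)"
      by (rule nn_integral_iid[OF p])
    also have "\<dots> = (\<integral>\<^sup>+xs. ennreal ?K + ennreal (real (elias_len (xs ! 0)))
        + ennreal ?c * (\<Sum>i\<in>{1..<n}. ennreal (?a i xs)) + (\<Sum>i<n. ennreal (?h (xs ! i))) \<partial>iid_pmf n p)"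
    proof (intro nn_integral_cong)
      fix xs
      have "ennreal (B xs) = ennreal ?K + ennreal (real (elias_len (xs ! 0)))
        + ennreal (?c * (\<Sum>i\<in>{1..<n}. ?a i xs)) + ennreal (\<Sum>i<n. ?h (xs ! i))"
        unfolding B_def
      proof (rule ennreal_plus4[OF K])
        show "0 \<le> ?c * (\<Sum>i\<in>{1..<n}. ?a i xs)"
          by (rule mult_nonneg_nonneg[OF c]) (simp add: sum_nonneg)
        show "0 \<le> (\<Sum>i<n. ?h (xs ! i))" by (rule sum_nonneg) (rule h)
      qed simp
      also have "ennreal (?c * (\<Sum>i\<in>{1..<n}. ?a i xs)) = ennreal ?c * (\<Sum>i\<in>{1..<n}. ennreal (?a i xs))"
        using c by (subst ennreal_mult) (auto intro!: sum_nonneg simp: sum_ennreal)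
      also have "ennreal (\<Sum>i<n. ?h (xs ! i)) = (\<Sum>i<n. ennreal (?h (xs ! i)))"
        by (rule sum_ennreal[symmetric]) (rule h)
      finally show "ennreal (B xs) = ennreal ?K + ennreal (real (elias_len (xs ! 0)))
        + ennreal ?c * (\<Sum>i\<in>{1..<n}. ennreal (?a i xs)) + (\<Sum>i<n. ennreal (?h (xs ! i)))" .
    qed
    also have "\<dots> = ennreal ?K + (\<integral>\<^sup>+xs. ennreal (real (elias_len (xs ! 0))) \<partial>iid_pmf n p)
        + ennreal ?c * (\<Sum>i\<in>{1..<n}. \<integral>\<^sup>+xs. ennreal (?a i xs) \<partial>iid_pmf n p)
        + (\<Sum>i<n. \<integral>\<^sup>+xs. ennreal (?h (xs ! i)) \<partial>iid_pmf n p)"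
      by (simp add: nn_integral_add nn_integral_cmult nn_integral_sum measure_pmf.emeasure_space_1 del: sum_ennreal)
    also have "\<dots> \<le> ennreal ?K + ennreal E0 + ennreal ?c * (\<Sum>i\<in>{1..<n}. ennreal (real V / real (Suc i)))
        + (\<Sum>i<n. ennreal T)"
    proof (intro add_mono mult_left_mono sum_mono)
      show "(\<integral>\<^sup>+xs. ennreal (real (elias_len (xs ! 0))) \<partial>iid_pmf n p) \<le> ennreal E0"
        using nn_integral_iid_nth[where i = 0 and n = n and h = "\<lambda>x. ennreal (real (elias_len x))" and p = p] n elias by simp
    next
      fix i assume "i \<in> {1..<n}"
      then have "(\<integral>\<^sup>+xs. (if etac_M (take i xs) < xs ! i \<and> xs ! i \<le> V then 1 else 0) \<partial>iid_pmf n p)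
          \<le> ennreal (real V / real (Suc i))"
        by (intro prob_censored_le) auto
      moreover have "ennreal (?a i xs) = (if etac_M (take i xs) < xs ! i \<and> xs ! i \<le> V then 1 else 0)" for xs
        by simp
      ultimately show "(\<integral>\<^sup>+xs. ennreal (?a i xs) \<partial>iid_pmf n p) \<le> ennreal (real V / real (Suc i))"
        by (simp only:)
    next
      fix i assume "i \<in> {..<n}"
      then have "(\<integral>\<^sup>+xs. ennreal (?h (xs ! i)) \<partial>iid_pmf n p) = (\<integral>\<^sup>+x. ennreal (?h x) \<partial>embed_pmf p)"
        by (intro nn_integral_iid_nth) simp
      also have "\<dots> = (\<integral>\<^sup>+x. (if V < x then ennreal (3 + log 2 (real n) + harm n + real (elias_len x)) else 0) \<partial>embed_pmf p)"
        by (intro nn_integral_cong) simp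
      finally show "(\<integral>\<^sup>+xs. ennreal (?h (xs ! i)) \<partial>iid_pmf n p) \<le> ennreal T" using tail by simp
    qed auto
    also have "\<dots> = ennreal (?K + E0 + ?c * (\<Sum>i\<in>{1..<n}. real V / real (Suc i)) + real n * T)"
    proof -
      have "ennreal ?c * (\<Sum>i\<in>{1..<n}. ennreal (real V / real (Suc i))) = ennreal (?c * (\<Sum>i\<in>{1..<n}. real V / real (Suc i)))"
        using c by (subst ennreal_mult) (auto intro!: sum_nonneg simp: sum_ennreal)
      moreover have "(\<Sum>i<n. ennreal T) = ennreal (real n * T)"
        using T by (simp add: ennreal_mult ennreal_of_nat_eq_real_of_nat)
      moreover have "0 \<le> ?c * (\<Sum>i\<in>{1..<n}. real V / real (Suc i))"
        using c by (intro mult_nonneg_nonneg sum_nonneg) auto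
      ultimately show ?thesis using K E0 T by (simp only: ennreal_plus add_nonneg_nonneg mult_nonneg_nonneg of_nat_0_le_iff)
    qed
    also have "\<dots> \<le> ennreal (?K + E0 + ?c * (real V * ?H) + real n * T)"
    proof (intro ennreal_leI add_mono mult_left_mono order_refl c)
      have "(\<Sum>i\<in>{1..<n}. real V / real (Suc i)) = real V * (\<Sum>i\<in>{1..<n}. inverse (real (Suc i)))"
        by (simp only: sum_distrib_left divide_inverse)
      also have "\<dots> \<le> real V * (\<Sum>i<n. inverse (real (Suc i)))"
        by (intro mult_left_mono sum_mono2) auto
      finally show "(\<Sum>i\<in>{1..<n}. real V / real (Suc i)) \<le> real V * ?H" by (simp only: harm_altdef)
    qed simp_all
    finally show "(\<integral>\<^sup>+xs. ennreal (iid_prob p xs) * ennreal (B xs) \<partial>count_space (seqs n))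
       \<le> ennreal (?K + E0 + ?c * (real V * ?H) + real n * T)" .
  qed
qed

section \<open>Cost of large symbols, uniformly over the envelope class\<close>

lemma harm_le_ln:
  assumes "1 \<le> n"
  shows "harm n \<le> 1 + ln (real n)"
proof -
  have "harm (Suc (n - 1)) - ln (real (Suc (n - 1))) \<le> harm (Suc 0) - ln (real (Suc 0))"
    using decseq_harm_diff_ln by (rule decseqD) simp
  then show ?thesis using assms by (simp add: harm_def)
qed

text \<open>A crude linear bound is enough where codeword lengths are averaged over geometrically
  decaying tails, and linearity suits summation by parts.\<close>

lemma elias_len_le_linear:
  assumes "1 \<le> k"
  shows "real (elias_len k) \<le> 3 * real k"
proof -
  have "k \<le> 2 ^ (k - 1)" using less_exp[of "k - 1"] assms by linarith
  then have "real k \<le> real (2 ^ (k - 1))" by (simp only: of_nat_le_iff)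
  then have "real k \<le> 2 ^ (k - 1)" by simp
  then have "log 2 (real k) \<le> log 2 (2 ^ (k - 1))" using assms by (intro log_mono) auto
  then have 1: "log 2 (real k) \<le> real k - 1" using assms by (simp add: log_nat_power of_nat_diff)
  have "0 \<le> log 2 (real k)" using assms by simp
  then have "log 2 (1 + log 2 (real k)) \<le> log 2 (real k)"
    using 1 by (intro log_mono) linarith+
  then show ?thesis using elias_len_le[OF assms] 1 by linarith
qed

context log_concave_envelope
begin

text \<open>Beyond a point \<open>a\<close> with negative log tail, the extended chord from the
  origin dominates the log tail, so the tail decays geometrically.\<close>

lemma summable_survival: "summable (\<lambda>k. survival (real k))"
proof -
  obtain a :: nat where a: "1 \<le> a" "log_survival (real a) < 0"
    using exists_log_survival_neg by blast
  define q where "q = 2 powr (log_survival (real a) / real a)"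
  have q: "0 < q" "q < 1" unfolding q_def using a by (auto simp: powr_less_one divide_neg_pos)
  show ?thesis
  proof (rule summable_comparison_test'[where N = a])
    show "summable (\<lambda>k. q ^ k)" using q by (intro summable_geometric) simp
    fix k assume k: "a \<le> k"
    have "real a / real k * log_survival (real k) \<le> log_survival (real a / real k * real k)"
      using a k by (intro log_survival_scale) auto
    then have "log_survival (real k) \<le> log_survival (real a) / real a * real k"
      using a k by (simp add: field_simps)
    then have "survival (real k) \<le> 2 powr (log_survival (real a) / real a * real k)"
      unfolding survival_eq_powr by simp
    also have "\<dots> = q ^ k" by (simp add: q_def powr_power mult.commute)
    finally show "norm (survival (real k)) \<le> q ^ k" using survival_pos[of "real k"] by simp
  qed
qed

text \<open>The mean of the envelope distribution, as a sum of its tails.\<close>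

definition survival_total :: real where "survival_total = (\<Sum>k. survival (real k))"

lemma survival_total_nonneg: "0 \<le> survival_total"
  unfolding survival_total_def by (intro suminf_nonneg summable_survival less_imp_le survival_pos)

text \<open>Summation by parts turns index weights into a sum of tails beyond \<open>V\<close>;
  submultiplicativity then takes out the tail at \<open>V\<close> and leaves a convergent
  sum.\<close>

lemma f_weighted_tail:
  assumes V: "tail_sum f V < 1" and R: "0 \<le> R"
  shows "(\<Sum>i. ennreal (f (Suc (i + V)) * (R + 3 * real (Suc (i + V)))))
    \<le> ennreal (survival (real V) * (R + 3 * real V + 3 * survival_total))"
proof -
  have surv: "survival (real (i + V)) = tail_sum f (i + V)" for i
    using tail_sum_lt_1_mono[OF V, of "i + V"] unfolding survival_of_nat by simp
  have abel: "(\<Sum>i<n. f (Suc (i + V)) * real (Suc i)) = (\<Sum>i<n. tail_sum f (i + V)) - real n * tail_sum f (n + V)" for n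
    by (induction n) (simp_all add: tail_sum_Suc[of "_ + V"] algebra_simps)
  have "(\<Sum>i<n. f (Suc (i + V)) * (R + 3 * real (Suc (i + V))))
     \<le> survival (real V) * (R + 3 * real V + 3 * survival_total)" for n
  proof -
    have "(\<Sum>i<n. f (Suc (i + V))) \<le> tail_sum f V"
      unfolding tail_sum_def using less_imp_le[OF f_pos]
      by (intro sum_le_suminf summable_f_Suc) auto
    then have 1: "(R + 3 * real V) * (\<Sum>i<n. f (Suc (i + V))) \<le> (R + 3 * real V) * survival (real V)"
      using R surv[of 0] by (intro mult_left_mono) auto
    have "(\<Sum>i<n. f (Suc (i + V)) * real (Suc i)) \<le> (\<Sum>i<n. survival (real (i + V)))"
      using tail_sum_pos[of "n + V"] unfolding abel surv by simp
    also have "\<dots> \<le> (\<Sum>i<n. survival (real V) * survival (real i))"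
      using survival_submult[of "real V"] by (intro sum_mono) (simp add: add.commute)
    also have "\<dots> \<le> survival (real V) * survival_total"
      unfolding sum_distrib_left[symmetric] survival_total_def
      using less_imp_le[OF survival_pos]
      by (intro mult_left_mono sum_le_suminf summable_survival) auto
    finally have 2: "(\<Sum>i<n. f (Suc (i + V)) * real (Suc i)) \<le> survival (real V) * survival_total" .
    have "(\<Sum>i<n. f (Suc (i + V)) * (R + 3 * real (Suc (i + V))))
       = (R + 3 * real V) * (\<Sum>i<n. f (Suc (i + V))) + 3 * (\<Sum>i<n. f (Suc (i + V)) * real (Suc i))"
      unfolding sum_distrib_left sum.distrib[symmetric] by (intro sum.cong) (auto simp: algebra_simps)
    then show ?thesis using 1 2 by (simp add: algebra_simps)
  qed
  then have "(\<Sum>i<n. ennreal (f (Suc (i + V)) * (R + 3 * real (Suc (i + V)))))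
     \<le> ennreal (survival (real V) * (R + 3 * real V + 3 * survival_total))" for n
    using R less_imp_le[OF f_pos] by (subst sum_ennreal) (auto intro!: ennreal_leI mult_nonneg_nonneg)
  then show ?thesis unfolding suminf_eq_SUP by (intro SUP_least)
qed

lemma envelope_tail_cost:
  assumes p: "p \<in> envelope_class f" and V: "tail_sum f V < 1" and R: "0 \<le> R"
  shows "(\<integral>\<^sup>+x. (if V < x then ennreal (R + real (elias_len x)) else 0) \<partial>embed_pmf p)
    \<le> ennreal (survival (real V) * (R + 3 * real V + 3 * survival_total))"
proof -
  have src: "is_source p" using p by (auto simp: is_source_def envelope_class_def)
  let ?h = "\<lambda>x. if V < x then ennreal (R + real (elias_len x)) else 0"
  have "(\<integral>\<^sup>+x. ?h x \<partial>embed_pmf p) = (\<Sum>j. ennreal (p (Suc j)) * ?h (Suc j))"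
    by (rule nn_integral_source[OF src])
  also have "\<dots> = (\<Sum>j. ennreal (p (Suc (j + V))) * ?h (Suc (j + V))) + (\<Sum>j<V. ennreal (p (Suc j)) * ?h (Suc j))"
    by (rule suminf_offset) simp
  also have "(\<Sum>j<V. ennreal (p (Suc j)) * ?h (Suc j)) = 0" by (intro sum.neutral) auto
  also have "(\<Sum>j. ennreal (p (Suc (j + V))) * ?h (Suc (j + V))) + 0
     \<le> (\<Sum>i. ennreal (f (Suc (i + V)) * (R + 3 * real (Suc (i + V)))))"
    unfolding add_0_right
  proof (intro suminf_le)
    fix i
    have "p (Suc (i + V)) * (R + real (elias_len (Suc (i + V)))) \<le> f (Suc (i + V)) * (R + 3 * real (Suc (i + V)))"
      using p R elias_len_le_linear[of "Suc (i + V)"] less_imp_le[OF f_pos]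
      by (intro mult_mono) (auto simp: envelope_class_def)
    moreover have "ennreal (p (Suc (i + V))) * ?h (Suc (i + V))
        = ennreal (p (Suc (i + V)) * (R + real (elias_len (Suc (i + V)))))"
      using p R by (subst ennreal_mult) (auto simp: envelope_class_def)
    ultimately show "ennreal (p (Suc (i + V))) * ?h (Suc (i + V)) \<le> ennreal (f (Suc (i + V)) * (R + 3 * real (Suc (i + V))))"
      by (simp only: ennreal_leI)
  qed auto
  also have "\<dots> \<le> ennreal (survival (real V) * (R + 3 * real V + 3 * survival_total))"
    by (rule f_weighted_tail[OF V R])
  finally show ?thesis .
qed

text \<open>Up to \<open>L\<close> the sum of all codeword lengths is a crude bound; beyond
  \<open>L\<close> the tail cost with \<open>R = 0\<close> applies. Both depend on the envelope
  alone.\<close>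

lemma envelope_elias_cost:
  "\<exists>E0\<ge>0. \<forall>p\<in>envelope_class f. (\<integral>\<^sup>+x. ennreal (real (elias_len x)) \<partial>embed_pmf p) \<le> ennreal E0"
proof -
  obtain L where L: "tail_sum f L < 1" using exists_absorbing_prefix by blast
  define E1 where "E1 = (\<Sum>k\<le>L. real (elias_len k))"
  define E2 where "E2 = survival (real L) * (0 + 3 * real L + 3 * survival_total)"
  have nn: "0 \<le> E1" "0 \<le> E2" unfolding E1_def E2_def
    using survival_pos[of "real L"] survival_total_nonneg by (auto intro!: sum_nonneg)
  have "(\<integral>\<^sup>+x. ennreal (real (elias_len x)) \<partial>embed_pmf p) \<le> ennreal (E1 + E2)"
    if p: "p \<in> envelope_class f" for p
  proof -
    have "(\<integral>\<^sup>+x. ennreal (real (elias_len x)) \<partial>embed_pmf p)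
        \<le> (\<integral>\<^sup>+x. ennreal E1 + (if L < x then ennreal (0 + real (elias_len x)) else 0) \<partial>embed_pmf p)"
    proof (intro nn_integral_mono)
      fix x
      show "ennreal (real (elias_len x)) \<le> ennreal E1 + (if L < x then ennreal (0 + real (elias_len x)) else 0)"
      proof (cases "L < x")
        case False
        then have "real (elias_len x) \<le> E1" unfolding E1_def by (intro member_le_sum) auto
        then show ?thesis using False by (simp add: ennreal_leI)
      qed simp
    qed
    also have "\<dots> = ennreal E1 + (\<integral>\<^sup>+x. (if L < x then ennreal (0 + real (elias_len x)) else 0) \<partial>embed_pmf p)"
      by (subst nn_integral_add) (simp_all add: measure_pmf.emeasure_space_1)
    also have "\<dots> \<le> ennreal E1 + ennreal E2"
      unfolding E2_def by (intro add_left_mono envelope_tail_cost[OF p L]) simp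
    finally show ?thesis using nn by simp
  qed
  then show ?thesis using nn by (intro exI[of _ "E1 + E2"]) auto
qed

text \<open>No vanishing correction to the constant \<open>2\<close> is needed: the leading constant is only
  \<open>5/4 * ln 2 * 2\<close>, where \<open>5/4\<close> comes from the cut-off, \<open>ln 2\<close> from the harmonic sum, and \<open>2\<close> from
  the two logarithms paid for a censored symbol (its past count and its Elias codeword).\<close>
lemma redundancy_etac_upper:
  "\<forall>\<^sub>F n in sequentially. redundancy f n (etac_prob n)
     \<le> ereal (2 * threshold n * log 2 (real n) * log 2 (threshold n))"
proof -
  obtain L where L: "tail_sum f L < 1" using exists_absorbing_prefix by blast
  obtain E0 where E0: "0 \<le> E0" and elias: "\<And>p. p \<in> envelope_class f \<Longrightarrow>
      (\<integral>\<^sup>+x. ennreal (real (elias_len x)) \<partial>embed_pmf p) \<le> ennreal E0"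
    using envelope_elias_cost by blast
  obtain C where C: "0 < C" and thr: "\<forall>\<^sub>F n in sequentially. threshold n \<le> C * log 2 (real n)"
    using threshold_le_log by blast
  define m where "m = threshold"
  define l where "l n = log 2 (real n)" for n :: nat
  define k where "k n = log 2 (m n)" for n
  \<comment> \<open>With the next line, \<open>b + l n * d\<close> bounds the cost factor of a
    symbol beyond \<open>V\<close>: 7 is 4 from \<open>R\<close> plus 3 from rounding
    \<open>V\<close> up, and \<open>15/4 * C\<close> comes from
    \<open>3 * (5/4 * m n)\<close>.\<close>
  define b where "b = 7 + 3 * survival_total"
  define d where "d = 1 + ln 2 + 15/4 * C"
  \<comment> \<open>The total bound divided by \<open>m n * l n * k n\<close>, written with inverses
    so that the limit can be taken term by term.\<close>
  define G where "G n = (5/4 + inverse (m n)) * (inverse (l n) + ln 2)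
      * (4 * inverse (k n) + 2 + 2 * (log 2 (2 + k n) / k n))
    + inverse (m n) * inverse (k n) * (2 * inverse (l n) + 1)
    + (15/4 + 4 * inverse (m n)) * (inverse (l n) + ln 2) * inverse (k n)
    + E0 * inverse (m n) * inverse (l n) * inverse (k n) + inverse (k n) * (b * inverse (l n) + d)" for n
  have l_lim: "filterlim l at_top sequentially" unfolding l_def by (rule log_nat_at_top)
  have m_lim: "filterlim m at_top sequentially" unfolding m_def by (rule threshold_at_top)
  have log_lim: "filterlim (log 2) at_top (at_top :: real filter)"
  proof -
    have "filterlim (\<lambda>x. 1 / ln 2 * ln x) at_top (at_top :: real filter)"
      by (rule filterlim_tendsto_pos_mult_at_top[OF tendsto_const]) (auto intro: ln_at_top)
    then show ?thesis by (simp add: log_def[abs_def])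
  qed
  have k_lim: "filterlim k at_top sequentially"
    unfolding k_def by (rule filterlim_compose[OF log_lim m_lim])
  have "((\<lambda>x::real. ln (2 + x) / x) \<longlongrightarrow> 0) at_top"
  proof -
    have "((\<lambda>x::real. ln (2 + x) / (2 + x) * (2 * inverse x + 1)) \<longlongrightarrow> 0 * (2 * 0 + 1)) at_top"
      by (intro tendsto_intros filterlim_compose[OF ln_x_over_x_tendsto_0] tendsto_inverse_0_at_top
          filterlim_tendsto_add_at_top[OF tendsto_const] filterlim_ident)
    moreover have "\<forall>\<^sub>F x in at_top. ln (2 + x) / (2 + x) * (2 * inverse x + 1) = ln (2 + x) / (x::real)"
      using eventually_gt_at_top[of 0]
    proof eventually_elim
      case (elim x)
      then have "2 * inverse x + 1 = (2 + x) / x" by (simp add: field_simps)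
      then show ?case using elim by simp
    qed
    ultimately show ?thesis by (simp add: tendsto_cong)
  qed
  then have "((\<lambda>x::real. ln (2 + x) / x / ln 2) \<longlongrightarrow> 0 / ln 2) at_top"
    by (rule tendsto_divide[OF _ tendsto_const]) simp
  then have "((\<lambda>x::real. log 2 (2 + x) / x) \<longlongrightarrow> 0) at_top"
    by (simp add: log_def mult.commute)
  then have kk: "(\<lambda>n. log 2 (2 + k n) / k n) \<longlonglongrightarrow> 0" by (rule filterlim_compose[OF _ k_lim])
  have inv: "(\<lambda>n. inverse (m n)) \<longlonglongrightarrow> 0" "(\<lambda>n. inverse (l n)) \<longlonglongrightarrow> 0" "(\<lambda>n. inverse (k n)) \<longlonglongrightarrow> 0"
    by (rule m_lim[THEN tendsto_inverse_0_at_top] l_lim[THEN tendsto_inverse_0_at_top]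
          k_lim[THEN tendsto_inverse_0_at_top])+
  have "G \<longlonglongrightarrow> (5/4 + 0) * (0 + ln 2) * (4 * 0 + 2 + 2 * 0) + 0 * 0 * (2 * 0 + 1)
    + (15/4 + 4 * 0) * (0 + ln 2) * 0 + E0 * 0 * 0 * 0 + 0 * (b * 0 + d)"
    unfolding G_def by (intro tendsto_intros inv kk)
  then have "G \<longlonglongrightarrow> 5/2 * ln 2" by simp
  moreover have "5/2 * ln 2 < (2::real)" using ln2_le_25_over_36 by simp
  ultimately have G2: "\<forall>\<^sub>F n in sequentially. G n < 2" by (rule order_tendstoD(2))
  have ev: "\<forall>\<^sub>F n in sequentially. 2 \<le> m n \<and> real L \<le> m n \<and> m n \<le> C * l n \<and> 2 \<le> n \<and> 1 \<le> l n"
    using m_lim l_lim thr unfolding m_def l_def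
    by (intro eventually_conj) (auto simp: filterlim_at_top intro: eventually_ge_at_top)
  have split: "((5/4 + inverse x) * (inverse y + a) * (4 * inverse z + 2 + 2 * (w / z))
    + inverse x * inverse z * (2 * inverse y + 1)
    + (15/4 + 4 * inverse x) * (inverse y + a) * inverse z
    + E0 * inverse x * inverse y * inverse z + inverse z * (b * inverse y + d)) * (x * y * z)
    = (5/4 * x + 1) * (1 + y * a) * (4 + 2 * z + 2 * w) + (2 + y) + (15/4 * x + 4) * (1 + y * a) + E0 + x * (b + y * d)"
    if "x \<noteq> 0" "y \<noteq> 0" "z \<noteq> 0" for x y z w a :: real
    using that by (simp add: field_simps)
  show ?thesis
    using ev G2
  proof eventually_elim
    case (elim n)
    define V where "V = nat \<lceil>5/4 * m n\<rceil>"
    let ?H = "harm n :: real"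
    have n: "1 \<le> n" and m: "2 \<le> m n" and l: "1 \<le> l n" using elim by auto
    have k: "1 \<le> k n" unfolding k_def using m by (simp add: le_log_iff)
    have Vm: "5/4 * m n \<le> real V" "real V \<le> 5/4 * m n + 1"
      unfolding V_def using m by linarith+
    have V1: "1 \<le> V" using Vm m by linarith
    have "real L \<le> real V" using Vm m elim by linarith
    then have tailV: "tail_sum f V < 1" using tail_sum_lt_1_mono[OF L, of V] by simp
    have H: "?H \<le> 1 + l n * ln 2" using harm_le_ln[OF n] by (simp add: l_def log_def)
    have H0: "0 \<le> ?H" by (simp add: harm_nonneg)
    have logV: "log 2 (real V) \<le> 1 + k n"
    proof -
      have "log 2 (real V) \<le> log 2 (2 * m n)" using Vm V1 m by (intro log_mono) linarith+
      then show ?thesis using m by (simp add: k_def log_mult)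
    qed
    have logV0: "0 \<le> log 2 (real V)" using V1 by simp
    have cV: "1 + log 2 (real V) + real (elias_len V) \<le> 4 + 2 * k n + 2 * log 2 (2 + k n)"
    proof -
      have "log 2 (1 + log 2 (real V)) \<le> log 2 (2 + k n)" using logV logV0 by (intro log_mono) linarith+
      then show ?thesis using elias_len_le[OF V1] logV by linarith
    qed
    define R where "R = 3 + log 2 (real n) + ?H"
    define T where "T = survival (real V) * (R + 3 * real V + 3 * survival_total)"
    have R: "0 \<le> R" using l H0 by (simp add: R_def l_def)
    have T0: "0 \<le> T" unfolding T_def
      using R survival_total_nonneg less_imp_le[OF survival_pos] by (intro mult_nonneg_nonneg) auto
    have nT: "real n * T \<le> m n * (b + l n * d)"
    proof -
      have mn: "0 < m n / real n" "m n / real n \<le> 1"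
        using threshold[OF n] survival_le_1[of "m n"] m n by (auto simp: m_def)
      have "survival (real V) \<le> (m n / real n) powr (5/4)"
        using Vm m n unfolding m_def by (intro survival_beyond_threshold) auto
      \<comment> \<open>The weaker exponent 1 suffices: about \<open>m n\<close> symbols beyond
        \<open>V\<close>, each costing \<open>O(l n)\<close>, stay a factor \<open>k n\<close> below
        the main term.\<close>
      also have "\<dots> \<le> (m n / real n) powr 1" using mn by (intro powr_mono') auto
      finally have "survival (real V) \<le> m n / real n" using mn by simp
      then have nS: "real n * survival (real V) \<le> m n" using n by (simp add: field_simps)
      have "R + 3 * real V + 3 * survival_total \<le> b + l n * d"
      proof -
        have "R \<le> 4 + l n + l n * ln 2" using H by (simp add: R_def l_def)
        moreover have "3 * real V \<le> 3 + l n * (15/4 * C)" using Vm elim by (simp add: algebra_simps)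
        ultimately show ?thesis unfolding b_def d_def by (simp add: algebra_simps)
      qed
      then have "real n * survival (real V) * (R + 3 * real V + 3 * survival_total) \<le> m n * (b + l n * d)"
        using nS R survival_total_nonneg m by (intro mult_mono) auto
      then show ?thesis by (simp add: T_def mult.assoc)
    qed
    define X where "X = log 2 (4 * real n) + (3 * real V + 1) * ?H + E0
       + (1 + log 2 (real V) + real (elias_len V)) * (real V * ?H) + real n * T"
    have "X \<le> 2 * m n * l n * k n"
    proof -
      have x1: "log 2 (4 * real n) = 2 + l n"
        using n by (simp add: l_def log_mult) (simp add: log_def ln_realpow[of 2 2, simplified])
      have x2: "(3 * real V + 1) * ?H \<le> (15/4 * m n + 4) * (1 + l n * ln 2)"
        using Vm m l H H0 by (intro mult_mono) auto
      have VH: "real V * ?H \<le> (5/4 * m n + 1) * (1 + l n * ln 2)"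
        using Vm m l H H0 by (intro mult_mono) auto
      have "(1 + log 2 (real V) + real (elias_len V)) * (real V * ?H)
        \<le> (4 + 2 * k n + 2 * log 2 (2 + k n)) * ((5/4 * m n + 1) * (1 + l n * ln 2))"
      proof (rule mult_mono[OF cV VH])
        show "0 \<le> 4 + 2 * k n + 2 * log 2 (2 + k n)" using cV logV0 by linarith
        show "0 \<le> real V * ?H" using H0 by simp
      qed
      then have "X \<le> (5/4 * m n + 1) * (1 + l n * ln 2) * (4 + 2 * k n + 2 * log 2 (2 + k n))
         + (2 + l n) + (15/4 * m n + 4) * (1 + l n * ln 2) + E0 + m n * (b + l n * d)"
        unfolding X_def x1 using x2 nT by (simp only: mult.commute)
      also have "\<dots> = G n * (m n * l n * k n)"
        unfolding G_def using m l k by (intro split[symmetric]) auto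
      also have "\<dots> \<le> 2 * (m n * l n * k n)"
        using elim m l k by (intro mult_right_mono) auto
      finally show ?thesis by (simp add: mult.assoc)
    qed
    moreover have "redundancy f n (etac_prob n) \<le> ereal X"
      unfolding redundancy_def
    proof (rule SUP_least)
      fix p assume p: "p \<in> envelope_class f"
      then have src: "is_source p" by (auto simp: is_source_def envelope_class_def)
      show "KL_div (seqs n) (iid_prob p) (etac_prob n) \<le> ereal X"
        unfolding X_def
        using KL_etac_le[OF src n V1 E0 T0 elias[OF p]] envelope_tail_cost[OF p tailV R]
        unfolding T_def R_def by simp
    qed
    ultimately show ?case
      unfolding m_def[symmetric] l_def[symmetric] k_def[symmetric]
      by (metis (no_types, lifting) ereal_less_eq(3) order_trans)
  qed
qed

end

theorem theorem4:
  fixes f :: "nat \<Rightarrow> real" and F :: "real \<Rightarrow> real" and m :: "nat \<Rightarrow> real"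
  assumes "is_envelope f"
    and "smoothed_envelope f F"
    and "nondecreasing_hazard_rate F"
    and "\<And>n. m n = exact_threshold F (real n)"
  shows "(\<exists>e :: nat \<Rightarrow> real. e \<longlonglongrightarrow> 0 \<and>
            (\<forall>\<^sub>F n in sequentially.
               ereal ((1/4 + e n) * m n * log 2 (real n)) \<le> minimax_redundancy f n))
       \<and> (\<forall>n\<ge>1. minimax_redundancy f n \<le> redundancy f n (etac_prob n))
       \<and> (\<exists>e :: nat \<Rightarrow> real. e \<longlonglongrightarrow> 0 \<and>
            (\<forall>\<^sub>F n in sequentially.
               redundancy f n (etac_prob n)
                 \<le> ereal ((2 + e n) * m n * log 2 (real n) * log 2 (m n))))
       \<and> (\<exists>e :: nat \<Rightarrow> real. e \<longlonglongrightarrow> 0 \<and>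
            (\<forall>\<^sub>F n in sequentially.
               redundancy f n (etac_prob n)
                 \<le> ereal ((8 + e n) * log 2 (m n)) * minimax_redundancy f n))
       \<and> (\<lambda>n::nat. log 2 (m n)) \<in> O(\<lambda>n::nat. log 2 (log 2 (real n)))"
proof -
  interpret log_concave_envelope f F
    using assms(1-3) by unfold_locales
  have m: "m = threshold" using assms(4) by (auto simp: threshold_def)
  obtain e where e: "e \<longlonglongrightarrow> 0" and lower: "\<forall>\<^sub>F n in sequentially.
      ereal ((1/4 + e n) * m n * log 2 (real n)) \<le> minimax_redundancy f n"
    using minimax_redundancy_lower unfolding m by blast
  have upper: "\<forall>\<^sub>F n in sequentially. redundancy f n (etac_prob n)
      \<le> ereal (2 * m n * log 2 (real n) * log 2 (m n))"
    using redundancy_etac_upper unfolding m .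
  have m1: "\<forall>\<^sub>F n in sequentially. 1 \<le> m n"
    using threshold_at_top unfolding m by (simp add: filterlim_at_top)
  have "\<forall>n\<ge>1. minimax_redundancy f n \<le> redundancy f n (etac_prob n)"
    unfolding minimax_redundancy_def by (auto intro!: INF_lower etac_prob_coding)
  moreover have "\<exists>e :: nat \<Rightarrow> real. e \<longlonglongrightarrow> 0 \<and> (\<forall>\<^sub>F n in sequentially.
      redundancy f n (etac_prob n) \<le> ereal ((2 + e n) * m n * log 2 (real n) * log 2 (m n)))"
    using upper by (intro exI[of _ "\<lambda>_. 0"]) simp
  moreover have "\<exists>e :: nat \<Rightarrow> real. e \<longlonglongrightarrow> 0 \<and> (\<forall>\<^sub>F n in sequentially.
      redundancy f n (etac_prob n) \<le> ereal ((8 + e n) * log 2 (m n)) * minimax_redundancy f n)"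
  proof (intro exI conjI)
    \<comment> \<open>The error term is the quotient of the constants of the upper and lower bounds,
      minus its limit.\<close>
    have "(\<lambda>n. 2 / (1/4 + e n) - 8) \<longlonglongrightarrow> 2 / (1/4 + 0) - 8"
      by (intro tendsto_intros e) simp
    then show "(\<lambda>n. 2 / (1/4 + e n) - 8) \<longlonglongrightarrow> 0" by simp
    have "\<forall>\<^sub>F n in sequentially. - (1/4) < e n" using e by (rule order_tendstoD) simp
    then show "\<forall>\<^sub>F n in sequentially. redundancy f n (etac_prob n)
        \<le> ereal ((8 + (2 / (1/4 + e n) - 8)) * log 2 (m n)) * minimax_redundancy f n"
      using lower upper m1
    proof eventually_elim
      case (elim n)
      then have pos: "0 < 1/4 + e n" "0 \<le> log 2 (m n)" by auto
      let ?q = "2 / (1/4 + e n) * log 2 (m n)"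
      have "redundancy f n (etac_prob n) \<le> ereal (2 * m n * log 2 (real n) * log 2 (m n))" by fact
      also have "2 * m n * log 2 (real n) * log 2 (m n) = ?q * ((1/4 + e n) * m n * log 2 (real n))"
        using pos(1) by (simp del: distrib_right_numeral)
      also have "ereal \<dots> = ereal ?q * ereal ((1/4 + e n) * m n * log 2 (real n))" by simp
      also have "\<dots> \<le> ereal ?q * minimax_redundancy f n"
        using elim pos by (intro ereal_mult_left_mono) auto
      finally show ?case by simp
    qed
  qed
  moreover have "(\<lambda>n. log 2 (m n)) \<in> O(\<lambda>n. log 2 (log 2 (real n)))"
  proof -
    obtain C where C: "0 < C" and thr: "\<forall>\<^sub>F n in sequentially. m n \<le> C * log 2 (real n)"
      using threshold_le_log unfolding m by blast
    have "\<forall>\<^sub>F n in sequentially. max 1 C \<le> log 2 (real n)"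
      using log_nat_at_top unfolding filterlim_at_top by blast
    with thr m1 have "\<forall>\<^sub>F n in sequentially. norm (log 2 (m n)) \<le> 2 * norm (log 2 (log 2 (real n)))"
    proof eventually_elim
      case (elim n)
      let ?l = "log 2 (real n)"
      have l: "1 \<le> ?l" "C \<le> ?l" using elim by auto
      \<comment> \<open>The constant \<open>C\<close> is absorbed by squaring \<open>?l\<close>, at
        the price of a factor 2 after taking logarithms.\<close>
      have "m n \<le> ?l * ?l" using elim l mult_right_mono[of C ?l ?l] by linarith
      then have "log 2 (m n) \<le> log 2 (?l * ?l)" using elim by (intro log_mono) auto
      also have "\<dots> = 2 * log 2 ?l" using l by (subst log_mult) auto
      finally show ?case using elim l by simp
    qed
    then show ?thesis by (rule bigoI)
  qed
  ultimately show ?thesis using e lower by blast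
qed

end
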